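(* Let $\bar{x} = x/\|x\|_2$. Assume that $\mu\bar{x}\in K$, where $K$ is a fixed star-shaped closed subset of $\mathbb{R}^n$. Then the estimator $\widehat{x} = P_K(\widehat{x}_{\mathrm{lin}})$, where $\widehat{x}_{\mathrm{lin}}=\frac1m\sum_{i=1}^m y_ia_i$, satisfies for every $t>0$: $$\mathbb{E}\,\|\widehat{x}-\mu\bar{x}\|_2 \le t + \frac{2}{\sqrt{m}}\Big[\sigma + \eta\,\frac{w_t(K)}{t}\Big].$$
   Context: Model (semiparametric single-index model): $x\in\mathbb{R}^n\setminus\{0\}$ is a fixed vector, $a_1,\dots,a_m$ are independent standard normal random vectors in $\mathbb{R}^n$, and $y_1,\dots,y_m$ are real-valued random variables such that the pairs $(a_i,y_i)$ are independent and identically distributed, and each $y_i$ depends on $a_i$ only through $\langle a_i,x\rangle$, i.e. given $\langle a_i,x\rangle$, $y_i$ and $a_i$ are conditionally independent. Parameters (assumed well defined and finite): $\mu=\mathbb{E}\,y_1\langle a_1,\bar{x}\rangle$, $\sigma^2=\mathrm{Var}(y_1\langle a_1,\bar{x}\rangle)$, $\eta^2=\mathbb{E}\,y_1^2$, with $\sigma,\eta\ge0$. A set $K$ is star-shaped if $\lambda K\subseteq K$ for all $0\le\lambda\le1$. $P_K(w)$ denotes the metric projection $\arg\min_{z\in K}\|w-z\|_2$ (any minimizer). The local mean width of $K$ at scale $t\geq 0$ is $w_t(K)=\mathbb{E}\sup\{\langle g,u-v\rangle: u,v\in K,\ \|u-v\|_2\le t\}$ with $g\sim N(0,I_n)$.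 *)

theory Defs
  imports "HOL-Probability.Probability"
begin

definition std_normal_vec_density :: "real ^ 'n \<Rightarrow> real" where
  "std_normal_vec_density z = (\<Prod>i\<in>UNIV. std_normal_density (z $ i))"

definition std_normal_vec :: "(real ^ 'n) measure" where
  "std_normal_vec = density lborel (\<lambda>z. ennreal (std_normal_vec_density z))"

text \<open>Conditional independence of the random elements \<open>X\<close> (values in \<open>S\<close>) and \<open>Y\<close>
  (values in \<open>T\<close>) given \<open>Z\<close> (values in \<open>R\<close>): conditional probabilities given the
  sigma-algebra generated by \<open>Z\<close> factorise almost surely.\<close>

definition cond_indep_var_given ::
    "'w measure \<Rightarrow> 'a measure \<Rightarrow> ('w \<Rightarrow> 'a) \<Rightarrow> 'b measure \<Rightarrow> ('w \<Rightarrow> 'b) \<Rightarrow>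
     'c measure \<Rightarrow> ('w \<Rightarrow> 'c) \<Rightarrow> bool" where
  "cond_indep_var_given M S X T Y R Z \<longleftrightarrow>
     (\<forall>A\<in>sets S. \<forall>B\<in>sets T.
        AE \<omega> in M.
          real_cond_exp M (vimage_algebra (space M) Z R)
              (indicator ((X -` A \<inter> space M) \<inter> (Y -` B \<inter> space M))) \<omega> =
          real_cond_exp M (vimage_algebra (space M) Z R) (indicator (X -` A \<inter> space M)) \<omega> *
          real_cond_exp M (vimage_algebra (space M) Z R) (indicator (Y -` B \<inter> space M)) \<omega>)"

text \<open>Unlike the library's \<^const>\<open>starlike\<close>, the centre is the origin.\<close>

definition star_shaped :: "'a::real_vector set \<Rightarrow> bool" where
  "star_shaped K \<longleftrightarrow> (\<forall>c::real. 0 \<le> c \<and> c \<le> 1 \<longrightarrow> (\<lambda>z. c *\<^sub>R z) ` K \<subseteq> K)"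

text \<open>The projection onto a non-convex closed set need not be unique, so it is set-valued.\<close>

definition metric_projections :: "'a::real_normed_vector set \<Rightarrow> 'a \<Rightarrow> 'a set" where
  "metric_projections K w = {z. is_arg_min (\<lambda>z. norm (w - z)) (\<lambda>z. z \<in> K) z}"

text \<open>For nonempty \<open>K\<close> and \<open>t \<ge> 0\<close> the supremum is over a nonempty set bounded by
  \<open>t * norm g\<close>, and it is continuous in \<open>g\<close>; so the real-valued supremum and the
  Bochner integral below are the intended (finite) quantities.\<close>

definition local_mean_width :: "(real ^ 'n) set \<Rightarrow> real \<Rightarrow> real" where
  "local_mean_width K t =
     (LINT g|std_normal_vec. Sup {g \<bullet> (u - v) | u v. u \<in> K \<and> v \<in> K \<and> norm (u - v) \<le> t})"

definition linear_estimator ::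
    "nat \<Rightarrow> (nat \<Rightarrow> 'w \<Rightarrow> real ^ 'n) \<Rightarrow> (nat \<Rightarrow> 'w \<Rightarrow> real) \<Rightarrow> 'w \<Rightarrow> real ^ 'n" where
  "linear_estimator m a y \<omega> = (1 / real m) *\<^sub>R (\<Sum>i=1..m. y i \<omega> *\<^sub>R a i \<omega>)"

end

theory Submission
  imports Defs
begin

text \<open>
  Let \<open>v = linear_estimator m a y \<omega> - \<mu> *\<^sub>R xbar\<close> be the error of the linear estimator, and let
  \<open>S\<close> be the support function of \<open>D = {u - u' | u u' \<in> K, norm (u - u') \<le> t}\<close>.

  The geometric part is deterministic. Comparing the projection with the competitor
  \<open>\<mu> *\<^sub>R xbar\<close> gives \<open>norm h ^ 2 \<le> 2 * (h \<bullet> v)\<close> for the error \<open>h\<close>. If \<open>h\<close> is longer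
  than \<open>t\<close>, shrinking both points of \<open>K\<close> by \<open>t / norm h\<close> puts a multiple of \<open>h\<close> of norm \<open>t\<close> into
  \<open>D\<close>, so \<open>norm h \<le> (2 / t) * S v\<close> (\<open>metric_projection_error_le\<close>).

  For the probabilistic part, \<open>a i\<close> is split into its component along \<open>xbar\<close> and
  its projection onto the orthogonal complement. The first components contribute to \<open>v\<close> a
  multiple of \<open>xbar\<close> whose factor is the deviation of an empirical mean from \<open>\<mu>\<close>; its
  expected absolute value is at most \<open>\<sigma> / sqrt m\<close>
  (\<open>abs_mean_deviation_le\<close>). The second components are independent of the
  responses, since the responses see \<open>a i\<close> only through the first components. Given the
  responses, their weighted sum is therefore a centred Gaussian vector in the complement, scaled
  by the Euclidean norm of the response vector (\<open>sum_response_orth_proj_law\<close>). That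
  norm has expectation at most \<open>sqrt m * \<eta>\<close>, and replacing the degenerate Gaussian by the full one
  can only increase the expectation of the convex function \<open>S\<close>, which leads to the local mean
  width (\<open>std_normal_vec_orth_proj_sublinear_le\<close>).

  Beyond the total mass, the first moment and the symmetry of the standard normal law, what is
  needed about Gaussian vectors (stability under linear combinations, independence of orthogonal
  components) is read off from one isometry argument, \<open>std_normal_vec_shears\<close>: a composition of three shears of the product of two
  copies of the space preserves volume, and if it also preserves the norm it preserves the product
  Gaussian. All estimates are made with nonnegative integrals, so that integrability of the error
  follows from the bound itself.
\<close>

section \<open>Standard normal vectors\<close>

lemma nn_integral_lborel_translate:
  fixes f :: "'a::euclidean_space \<Rightarrow> ennreal"
  assumes [measurable]: "f \<in> borel_measurable borel"
  shows "(\<integral>\<^sup>+x. f (x + c) \<partial>lborel) = (\<integral>\<^sup>+x. f x \<partial>lborel)"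
proof -
  have "(\<integral>\<^sup>+x. f x \<partial>lborel) = (\<integral>\<^sup>+x. f x \<partial>distr lborel borel ((+) c))"
    by (simp add: lborel_distr_plus)
  also have "\<dots> = (\<integral>\<^sup>+x. f (x + c) \<partial>lborel)"
    by (simp add: nn_integral_distr add.commute)
  finally show ?thesis by simp
qed

lemma nn_integral_lborel_shear_snd:
  fixes f :: "'a::euclidean_space \<Rightarrow> 'b::euclidean_space \<Rightarrow> ennreal"
  assumes [measurable]: "case_prod f \<in> borel_measurable (borel \<Otimes>\<^sub>M borel)"
  shows "(\<integral>\<^sup>+g. \<integral>\<^sup>+h. f g (h + V g) \<partial>lborel \<partial>lborel) = (\<integral>\<^sup>+g. \<integral>\<^sup>+h. f g h \<partial>lborel \<partial>lborel)"
  by (intro nn_integral_cong nn_integral_lborel_translate) measurable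

lemma nn_integral_lborel_shear_fst:
  fixes f :: "'a::euclidean_space \<Rightarrow> 'b::euclidean_space \<Rightarrow> ennreal"
  assumes [measurable]: "case_prod f \<in> borel_measurable (borel \<Otimes>\<^sub>M borel)"
    and [measurable]: "U \<in> borel_measurable borel"
  shows "(\<integral>\<^sup>+g. \<integral>\<^sup>+h. f (g + U h) h \<partial>lborel \<partial>lborel) = (\<integral>\<^sup>+g. \<integral>\<^sup>+h. f g h \<partial>lborel \<partial>lborel)"
proof -
  have "(\<integral>\<^sup>+g. \<integral>\<^sup>+h. f (g + U h) h \<partial>lborel \<partial>lborel) = (\<integral>\<^sup>+h. \<integral>\<^sup>+g. f (g + U h) h \<partial>lborel \<partial>lborel)"
    by (rule lborel_pair.Fubini'[symmetric]) measurable
  also have "\<dots> = (\<integral>\<^sup>+h. \<integral>\<^sup>+g. f g h \<partial>lborel \<partial>lborel)"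
    by (intro nn_integral_cong nn_integral_lborel_translate) measurable
  also have "\<dots> = (\<integral>\<^sup>+g. \<integral>\<^sup>+h. f g h \<partial>lborel \<partial>lborel)"
    by (rule lborel_pair.Fubini') measurable
  finally show ?thesis .
qed

lemma std_normal_vec_density_eq:
  "std_normal_vec_density (z :: real ^ 'n) =
     (1 / sqrt (2 * pi)) ^ CARD('n) * exp (- (norm z)\<^sup>2 / 2)"
  unfolding std_normal_vec_density_def std_normal_density_def prod.distrib
  by (simp add: exp_sum[symmetric] norm_vec_def L2_set_def sum_nonneg sum_negf sum_divide_distrib)

lemma std_normal_vec_density_nonneg: "0 \<le> std_normal_vec_density z"
  by (simp add: std_normal_vec_density_eq)

lemma std_normal_vec_density_measurable [measurable]:
  "std_normal_vec_density \<in> borel_measurable borel"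
  unfolding std_normal_vec_density_eq[abs_def] by measurable

lemma sets_std_normal_vec [measurable_cong, simp]: "sets std_normal_vec = sets borel"
  by (simp add: std_normal_vec_def)

lemma space_std_normal_vec [simp]: "space std_normal_vec = UNIV"
  by (simp add: std_normal_vec_def)

lemma nn_integral_std_normal_vec:
  assumes [measurable]: "F \<in> borel_measurable borel"
  shows "(\<integral>\<^sup>+g. F g \<partial>std_normal_vec) = (\<integral>\<^sup>+g. ennreal (std_normal_vec_density g) * F g \<partial>lborel)"
  unfolding std_normal_vec_def by (subst nn_integral_density) auto

text \<open>Integrals of products of functions of single coordinates factorise; total mass and first
  moment of the standard normal vector reduce to one dimension this way.\<close>

lemma nn_integral_lborel_vec_prod:
  fixes f :: "'n::finite \<Rightarrow> real \<Rightarrow> ennreal"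
  assumes [measurable]: "\<And>i. f i \<in> borel_measurable borel"
  shows "(\<integral>\<^sup>+z. (\<Prod>i\<in>UNIV. f i (z $ i)) \<partial>lborel) = (\<Prod>i\<in>UNIV. \<integral>\<^sup>+x. f i x \<partial>lborel)"
proof -
  have reindex: "(\<Prod>b\<in>Basis. G b) = (\<Prod>i\<in>UNIV. G (axis i 1))" for G :: "real ^ 'n \<Rightarrow> ennreal"
  proof -
    have "inj (\<lambda>i::'n. axis i (1::real))" by (auto simp: inj_on_def axis_eq_axis)
    moreover have "Basis = range (\<lambda>i::'n. axis i (1::real))" by (auto simp: Basis_vec_def)
    ultimately show ?thesis using prod.reindex[of "\<lambda>i::'n. axis i (1::real)" UNIV G] by (simp add: comp_def)
  qed
  \<comment> \<open>The factors are indexed by basis vectors in the product formula for Lebesgue measure.\<close>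
  define F where "F b = f (THE i. b = axis i 1)" for b :: "real ^ 'n"
  have F: "F (axis i 1) = f i" for i
    unfolding F_def by (simp add: axis_eq_axis)
  show ?thesis
    using nn_integral_lborel_prod[of F] unfolding reindex F inner_axis by (simp add: F_def)
qed

lemma prob_space_std_normal_vec: "prob_space (std_normal_vec :: (real ^ 'n) measure)"
proof
  have "(\<integral>\<^sup>+x. ennreal (std_normal_density x) \<partial>lborel) = 1"
    using prob_space.emeasure_space_1[OF prob_space_normal_density[of 1 0]]
    by (simp add: emeasure_density)
  then show "emeasure (std_normal_vec :: (real ^ 'n) measure) (space std_normal_vec) = 1"
    using nn_integral_lborel_vec_prod[of "\<lambda>_::'n. \<lambda>x. ennreal (std_normal_density x)"]
    by (simp add: std_normal_vec_def emeasure_density std_normal_vec_density_def prod_ennreal)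
qed

lemma integrable_norm_std_normal_vec: "integrable (std_normal_vec :: (real ^ 'n) measure) norm"
proof -
  have coord: "(\<integral>\<^sup>+g. ennreal \<bar>g $ k\<bar> \<partial>std_normal_vec) < \<infinity>" for k :: 'n
  proof -
    let ?f = "\<lambda>i x. ennreal (std_normal_density x * (if i = k then \<bar>x\<bar> else 1))"
    have "(\<integral>\<^sup>+g. ennreal \<bar>g $ k\<bar> \<partial>std_normal_vec) = (\<integral>\<^sup>+g. (\<Prod>i\<in>UNIV. ?f i (g $ i)) \<partial>lborel)"
      by (subst nn_integral_std_normal_vec)
         (auto intro!: nn_integral_cong
               simp: std_normal_vec_density_def prod_ennreal prod.distrib ennreal_mult'' prod_nonneg)
    also have "\<dots> = (\<Prod>i\<in>UNIV. \<integral>\<^sup>+x. ?f i x \<partial>lborel)"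
      by (intro nn_integral_lborel_vec_prod) auto
    also have "\<dots> < \<infinity>"
    proof -
      have "(\<integral>\<^sup>+x. ?f i x \<partial>lborel) < \<infinity>" for i
        using integrable_std_normal_moment_abs[of 1] integrable_std_normal_moment_abs[of 0]
        by (cases "i = k") (auto simp: integrable_iff_bounded abs_mult normal_density_nonneg)
      then show ?thesis
        by (simp add: less_top[symmetric] ennreal_prod_eq_top)
    qed
    finally show ?thesis .
  qed
  have "(\<integral>\<^sup>+g. ennreal (norm (g :: real^'n)) \<partial>std_normal_vec) \<le> (\<integral>\<^sup>+g. (\<Sum>k\<in>(UNIV :: 'n set). ennreal \<bar>g $ k\<bar>) \<partial>(std_normal_vec :: (real^'n) measure))"
    by (intro nn_integral_mono) (auto simp: ennreal_leI norm_le_l1_cart)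
  also have "\<dots> = (\<Sum>k\<in>(UNIV :: 'n set). \<integral>\<^sup>+g. ennreal \<bar>g $ k\<bar> \<partial>std_normal_vec)"
    by (rule nn_integral_sum) measurable
  also have "\<dots> < \<infinity>" using coord by (simp add: less_top[symmetric] )
  finally show ?thesis
    by (subst integrable_iff_bounded) auto
qed

lemma nn_integral_std_normal_vec_uminus:
  fixes F :: "real ^ 'n \<Rightarrow> ennreal"
  assumes [measurable]: "F \<in> borel_measurable borel"
  shows "(\<integral>\<^sup>+g. F (- g) \<partial>std_normal_vec) = (\<integral>\<^sup>+g. F g \<partial>std_normal_vec)"
proof -
  let ?\<rho> = "\<lambda>g. ennreal (std_normal_vec_density g)"
  have "lborel = density (distr lborel borel (uminus :: real ^ 'n \<Rightarrow> _)) (\<lambda>_. 1)"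
    using lborel_affine[of "-1" "0 :: real ^ 'n"] by (simp add: fun_eq_iff)
  then have "(\<integral>\<^sup>+g. ?\<rho> g * F g \<partial>lborel) = (\<integral>\<^sup>+g. ?\<rho> g * F g \<partial>distr lborel borel (uminus :: real ^ 'n \<Rightarrow> _))"
    by (simp add: density_1)
  also have "\<dots> = (\<integral>\<^sup>+g. ?\<rho> (- g) * F (- g) \<partial>lborel)"
    by (subst nn_integral_distr) auto
  finally show ?thesis
    by (simp add: nn_integral_std_normal_vec std_normal_vec_density_eq)
qed

text \<open>On pairs \<open>(g, h)\<close>, the map in question is the composition of the shears
  \<open>(g, h) \<mapsto> (g + U h, h)\<close>, \<open>(g, h) \<mapsto> (g, h + V g)\<close> and again \<open>(g, h) \<mapsto> (g + U h, h)\<close>.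
  Each preserves Lebesgue measure, by translation invariance in one variable, for arbitrary measurable
  \<open>U\<close> and \<open>V\<close>. The Gaussian density of a pair depends only on the sum of the squared norms, so if the
  composition preserves that sum, then the image of two independent standard normal vectors is
  again such a pair; here its first component is observed.\<close>

lemma std_normal_vec_shears:
  fixes F :: "real ^ 'n \<Rightarrow> ennreal" and U V :: "real ^ 'n \<Rightarrow> real ^ 'n"
  assumes [measurable]: "F \<in> borel_measurable borel" "U \<in> borel_measurable borel" "V \<in> borel_measurable borel"
    and isometry: "\<And>g h. (norm (g + U h + U (h + V (g + U h))))\<^sup>2 + (norm (h + V (g + U h)))\<^sup>2 = (norm g)\<^sup>2 + (norm h)\<^sup>2"
  shows "(\<integral>\<^sup>+g. \<integral>\<^sup>+h. F (g + U h + U (h + V (g + U h))) \<partial>std_normal_vec \<partial>std_normal_vec) = (\<integral>\<^sup>+g. F g \<partial>std_normal_vec)"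
proof -
  interpret prob_space "std_normal_vec :: (real ^ 'n) measure" by (rule prob_space_std_normal_vec)
  let ?\<rho> = "\<lambda>g :: real ^ 'n. ennreal (std_normal_vec_density g)"
  define f where "f g h = ?\<rho> g * ?\<rho> h * F g" for g h
  have [measurable]: "case_prod f \<in> borel_measurable (borel \<Otimes>\<^sub>M borel)"
    unfolding f_def by measurable
  have \<rho>: "?\<rho> g * ?\<rho> h = ?\<rho> g' * ?\<rho> h'" if "(norm g)\<^sup>2 + (norm h)\<^sup>2 = (norm g')\<^sup>2 + (norm h')\<^sup>2" for g h g' h'
  proof -
    have *: "std_normal_vec_density g * std_normal_vec_density h
       = ((1 / sqrt (2 * pi)) ^ CARD('n))\<^sup>2 * exp (- ((norm g)\<^sup>2 + (norm h)\<^sup>2) / 2)" for g h :: "real ^ 'n"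
      unfolding std_normal_vec_density_eq
      by (simp add: power2_eq_square mult_ac exp_add[symmetric])
    show ?thesis
      unfolding ennreal_mult'[OF std_normal_vec_density_nonneg, symmetric] * that ..
  qed
  have "(\<integral>\<^sup>+g. \<integral>\<^sup>+h. F (g + U h + U (h + V (g + U h))) \<partial>std_normal_vec \<partial>std_normal_vec)
      = (\<integral>\<^sup>+g. \<integral>\<^sup>+h. ?\<rho> g * ?\<rho> h * F (g + U h + U (h + V (g + U h))) \<partial>lborel \<partial>lborel)"
    by (simp add: nn_integral_std_normal_vec nn_integral_cmult[symmetric] mult.assoc)
  also have "\<dots> = (\<integral>\<^sup>+g. \<integral>\<^sup>+h. f (g + U h + U (h + V (g + U h))) (h + V (g + U h)) \<partial>lborel \<partial>lborel)"
    unfolding f_def by (subst \<rho>[OF isometry]) simp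
  also have "\<dots> = (\<integral>\<^sup>+g. \<integral>\<^sup>+h. f (g + U (h + V g)) (h + V g) \<partial>lborel \<partial>lborel)"
    by (rule nn_integral_lborel_shear_fst[of "\<lambda>g h. f (g + U (h + V g)) (h + V g)"]) measurable
  also have "\<dots> = (\<integral>\<^sup>+g. \<integral>\<^sup>+h. f (g + U h) h \<partial>lborel \<partial>lborel)"
    by (rule nn_integral_lborel_shear_snd[of "\<lambda>g h. f (g + U h) h"]) measurable
  also have "\<dots> = (\<integral>\<^sup>+g. \<integral>\<^sup>+h. f g h \<partial>lborel \<partial>lborel)"
    by (rule nn_integral_lborel_shear_fst) measurable
  also have "\<dots> = (\<integral>\<^sup>+g. ?\<rho> g * F g * (\<integral>\<^sup>+h. ?\<rho> h \<partial>lborel) \<partial>lborel)"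
    unfolding f_def by (simp add: nn_integral_cmult[symmetric] mult_ac)
  also have "\<dots> = (\<integral>\<^sup>+g. F g \<partial>std_normal_vec)"
    using nn_integral_std_normal_vec[of "\<lambda>_ :: real ^ 'n. 1"] emeasure_space_1
    by (simp add: nn_integral_std_normal_vec)
  finally show ?thesis .
qed

text \<open>The rotation \<open>(g, h) \<mapsto> (c g + s h, c h - s g)\<close> with \<open>c\<^sup>2 + s\<^sup>2 = 1\<close> and \<open>s \<noteq> 0\<close> is a
  product of three shears, with factors \<open>(1 - c) / s\<close>, \<open>- s\<close> and \<open>(1 - c) / s\<close>.
  For \<open>\<beta> = 0\<close> the shear factors are undefined, and the symmetry of the law replaces \<open>\<alpha>\<close> by
  \<open>\<bar>\<alpha>\<bar>\<close>.\<close>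

lemma std_normal_vec_linear_combination:
  fixes F :: "real ^ 'n \<Rightarrow> ennreal" and \<alpha> \<beta> :: real
  assumes [measurable]: "F \<in> borel_measurable borel"
  shows "(\<integral>\<^sup>+g. \<integral>\<^sup>+h. F (\<alpha> *\<^sub>R g + \<beta> *\<^sub>R h) \<partial>std_normal_vec \<partial>std_normal_vec)
       = (\<integral>\<^sup>+g. F (sqrt (\<alpha>\<^sup>2 + \<beta>\<^sup>2) *\<^sub>R g) \<partial>std_normal_vec)"
proof (cases "\<beta> = 0")
  case True
  interpret prob_space "std_normal_vec :: (real ^ 'n) measure" by (rule prob_space_std_normal_vec)
  have "(\<integral>\<^sup>+g. F (\<alpha> *\<^sub>R g) \<partial>std_normal_vec) = (\<integral>\<^sup>+g. F (\<bar>\<alpha>\<bar> *\<^sub>R g) \<partial>std_normal_vec)"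
    using nn_integral_std_normal_vec_uminus[of "\<lambda>g. F (\<alpha> *\<^sub>R g)"] by (cases "\<alpha> \<ge> 0") auto
  then show ?thesis using True emeasure_space_1 by simp
next
  case False
  define r where "r = sqrt (\<alpha>\<^sup>2 + \<beta>\<^sup>2)"
  have "r > 0" using False by (simp add: r_def sum_power2_gt_zero_iff)
  define c s u where "c = \<alpha> / r" and "s = \<beta> / r" and "u = (1 - c) / s"
  have cs: "c\<^sup>2 + s\<^sup>2 = 1"
    using False by (simp add: c_def s_def power_divide add_divide_distrib[symmetric] r_def sum_power2_gt_zero_iff)
  have "s \<noteq> 0" using False \<open>r > 0\<close> by (simp add: s_def)
  then have us: "s * u = 1 - c" and uc: "u * (1 + c) = s"
    using cs by (simp_all add: u_def field_simps power2_eq_square)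
  have h1: "h + (- s) *\<^sub>R (g + u *\<^sub>R h) = c *\<^sub>R h - s *\<^sub>R g" for g h :: "real ^ 'n"
  proof -
    have "h + (- s) *\<^sub>R (g + u *\<^sub>R h) = (1 - s * u) *\<^sub>R h - s *\<^sub>R g" by (simp add: algebra_simps)
    then show ?thesis by (simp add: us)
  qed
  have g2: "g + u *\<^sub>R h + u *\<^sub>R (c *\<^sub>R h - s *\<^sub>R g) = c *\<^sub>R g + s *\<^sub>R h" for g h :: "real ^ 'n"
  proof -
    have "g + u *\<^sub>R h + u *\<^sub>R (c *\<^sub>R h - s *\<^sub>R g) = (1 - s * u) *\<^sub>R g + (u * (1 + c)) *\<^sub>R h" by (simp add: algebra_simps)
    then show ?thesis by (simp add: us uc)
  qed
  have iso: "(norm (c *\<^sub>R g + s *\<^sub>R h))\<^sup>2 + (norm (c *\<^sub>R h - s *\<^sub>R g))\<^sup>2 = (norm g)\<^sup>2 + (norm h)\<^sup>2" for g h :: "real ^ 'n"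
  proof -
    have "(norm (c *\<^sub>R g + s *\<^sub>R h))\<^sup>2 + (norm (c *\<^sub>R h - s *\<^sub>R g))\<^sup>2 = (c\<^sup>2 + s\<^sup>2) * ((norm g)\<^sup>2 + (norm h)\<^sup>2)"
      unfolding power2_norm_eq_inner by (simp add: algebra_simps inner_commute power2_eq_square)
    then show ?thesis by (simp add: cs)
  qed
  have "(\<integral>\<^sup>+g. \<integral>\<^sup>+h. F (r *\<^sub>R (c *\<^sub>R g + s *\<^sub>R h)) \<partial>std_normal_vec \<partial>std_normal_vec) = (\<integral>\<^sup>+g. F (r *\<^sub>R g) \<partial>std_normal_vec)"
    using std_normal_vec_shears[of "\<lambda>g. F (r *\<^sub>R g)" "\<lambda>h. u *\<^sub>R h" "\<lambda>g. (- s) *\<^sub>R g"]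
    unfolding h1 g2 iso by simp
  moreover have "r *\<^sub>R (c *\<^sub>R g + s *\<^sub>R h) = \<alpha> *\<^sub>R g + \<beta> *\<^sub>R h" for g h :: "real ^ 'n"
    using \<open>r > 0\<close> by (simp add: c_def s_def scaleR_add_right)
  ultimately show ?thesis unfolding r_def by simp
qed

definition orth_proj :: "'a::real_inner \<Rightarrow> 'a \<Rightarrow> 'a" where
  "orth_proj e v = v - (v \<bullet> e) *\<^sub>R e"

lemma orth_proj_measurable [measurable]:
  "orth_proj (e :: 'a::euclidean_space) \<in> borel_measurable borel"
  unfolding orth_proj_def[abs_def] by measurable

lemma linear_orth_proj: "linear (orth_proj e)"
  unfolding orth_proj_def[abs_def] by (intro linearI) (auto simp: algebra_simps)

text \<open>Exchanging the components of \<open>g\<close> and \<open>h\<close> orthogonal to \<open>e\<close> (up to a sign) is an isometry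
  of pairs, and a product of three shears: if \<open>P\<close> is the orthogonal projection, take
  \<open>U = P\<close> and \<open>V = - P\<close>. So the two components of a standard normal vector may be taken from
  independent copies.\<close>

lemma std_normal_vec_split:
  fixes F :: "real ^ 'n \<Rightarrow> ennreal" and e :: "real ^ 'n"
  assumes [measurable]: "F \<in> borel_measurable borel" and e: "norm e = 1"
  shows "(\<integral>\<^sup>+g. \<integral>\<^sup>+h. F ((g \<bullet> e) *\<^sub>R e + orth_proj e h) \<partial>std_normal_vec \<partial>std_normal_vec) = (\<integral>\<^sup>+g. F g \<partial>std_normal_vec)"
proof -
  have ee: "e \<bullet> e = 1" using e by (simp add: norm_eq_1)
  have h1: "h + - orth_proj e (g + orth_proj e h) = (h \<bullet> e) *\<^sub>R e - orth_proj e g" for g h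
    by (simp add: orth_proj_def algebra_simps ee)
  have g2: "g + orth_proj e h + orth_proj e ((h \<bullet> e) *\<^sub>R e - orth_proj e g) = (g \<bullet> e) *\<^sub>R e + orth_proj e h" for g h
    by (simp add: orth_proj_def algebra_simps ee)
  have iso: "(norm ((g \<bullet> e) *\<^sub>R e + orth_proj e h))\<^sup>2 + (norm ((h \<bullet> e) *\<^sub>R e - orth_proj e g))\<^sup>2 = (norm g)\<^sup>2 + (norm h)\<^sup>2" for g h
    unfolding power2_norm_eq_inner orth_proj_def by (simp add: algebra_simps ee inner_commute)
  show ?thesis
    using std_normal_vec_shears[of F "orth_proj e" "\<lambda>g. - orth_proj e g"]
    unfolding h1 g2 iso by simp
qed

lemma std_normal_vec_indep_orth_proj:
  fixes H :: "real \<Rightarrow> real ^ 'n \<Rightarrow> ennreal"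
  assumes [measurable]: "case_prod H \<in> borel_measurable (borel \<Otimes>\<^sub>M borel)" and e: "norm e = 1"
  shows "(\<integral>\<^sup>+g. H (g \<bullet> e) (orth_proj e g) \<partial>std_normal_vec)
       = (\<integral>\<^sup>+g. \<integral>\<^sup>+h. H (g \<bullet> e) (orth_proj e h) \<partial>std_normal_vec \<partial>std_normal_vec)"
proof -
  have ee: "e \<bullet> e = 1" using e by (simp add: norm_eq_1)
  have "((g \<bullet> e) *\<^sub>R e + orth_proj e h) \<bullet> e = g \<bullet> e"
    and "orth_proj e ((g \<bullet> e) *\<^sub>R e + orth_proj e h) = orth_proj e h" for g h
    by (simp_all add: orth_proj_def algebra_simps ee)
  then show ?thesis
    using std_normal_vec_split[of "\<lambda>w. H (w \<bullet> e) (orth_proj e w)", OF _ e] by simp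
qed

text \<open>Jensen's inequality in a symmetrised form: the projection of \<open>h\<close> is the midpoint of
  \<open>(g \<bullet> e) e + P h\<close> and \<open>- (g \<bullet> e) e + P h\<close>, both of which are standard normal.\<close>

lemma std_normal_vec_orth_proj_sublinear_le:
  fixes S :: "real ^ 'n \<Rightarrow> real"
  assumes [measurable]: "S \<in> borel_measurable borel" and e: "norm e = 1"
    and nonneg: "\<And>v. 0 \<le> S v" and sub: "\<And>u v. S (u + v) \<le> S u + S v"
    and hom: "\<And>c v. 0 \<le> c \<Longrightarrow> S (c *\<^sub>R v) = c * S v"
  shows "(\<integral>\<^sup>+g. ennreal (S (orth_proj e g)) \<partial>std_normal_vec) \<le> (\<integral>\<^sup>+g. ennreal (S g) \<partial>std_normal_vec)"
proof -
  interpret prob_space "std_normal_vec :: (real ^ 'n) measure" by (rule prob_space_std_normal_vec)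
  let ?I = "\<integral>\<^sup>+g. ennreal (S g) \<partial>std_normal_vec"
  have pt: "2 * ennreal (S (orth_proj e h)) \<le> ennreal (S ((g \<bullet> e) *\<^sub>R e + orth_proj e h)) + ennreal (S ((- g \<bullet> e) *\<^sub>R e + orth_proj e h))" for g h
  proof -
    have "2 * S (orth_proj e h) = S (2 *\<^sub>R orth_proj e h)" by (simp add: hom)
    also have "2 *\<^sub>R orth_proj e h = ((g \<bullet> e) *\<^sub>R e + orth_proj e h) + ((- g \<bullet> e) *\<^sub>R e + orth_proj e h)"
      by (simp add: algebra_simps scaleR_2)
    also have "S \<dots> \<le> S ((g \<bullet> e) *\<^sub>R e + orth_proj e h) + S ((- g \<bullet> e) *\<^sub>R e + orth_proj e h)" by (rule sub)
    finally have "ennreal (2 * S (orth_proj e h)) \<le> ennreal (S ((g \<bullet> e) *\<^sub>R e + orth_proj e h) + S ((- g \<bullet> e) *\<^sub>R e + orth_proj e h))"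
      by (rule ennreal_leI)
    then show ?thesis by (simp add: ennreal_mult' nonneg)
  qed
  have "2 * (\<integral>\<^sup>+h. ennreal (S (orth_proj e h)) \<partial>std_normal_vec)
      = (\<integral>\<^sup>+g. \<integral>\<^sup>+h. 2 * ennreal (S (orth_proj e h)) \<partial>std_normal_vec \<partial>(std_normal_vec :: (real ^ 'n) measure))"
    using emeasure_space_1 by (simp add: nn_integral_cmult)
  also have "\<dots> \<le> (\<integral>\<^sup>+g. \<integral>\<^sup>+h. (ennreal (S ((g \<bullet> e) *\<^sub>R e + orth_proj e h)) + ennreal (S ((- g \<bullet> e) *\<^sub>R e + orth_proj e h))) \<partial>std_normal_vec \<partial>std_normal_vec)"
    by (intro nn_integral_mono pt)
  also have "\<dots> = (\<integral>\<^sup>+g. \<integral>\<^sup>+h. ennreal (S ((g \<bullet> e) *\<^sub>R e + orth_proj e h)) \<partial>std_normal_vec \<partial>std_normal_vec)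
                + (\<integral>\<^sup>+g. \<integral>\<^sup>+h. ennreal (S ((- g \<bullet> e) *\<^sub>R e + orth_proj e h)) \<partial>std_normal_vec \<partial>std_normal_vec)"
    by (subst nn_integral_add[symmetric]) (auto intro!: nn_integral_cong nn_integral_add)
  also have "(\<integral>\<^sup>+g. \<integral>\<^sup>+h. ennreal (S ((- g \<bullet> e) *\<^sub>R e + orth_proj e h)) \<partial>std_normal_vec \<partial>std_normal_vec)
           = (\<integral>\<^sup>+g. \<integral>\<^sup>+h. ennreal (S ((g \<bullet> e) *\<^sub>R e + orth_proj e h)) \<partial>std_normal_vec \<partial>std_normal_vec)"
    by (rule nn_integral_std_normal_vec_uminus[of "\<lambda>g. \<integral>\<^sup>+h. ennreal (S ((g \<bullet> e) *\<^sub>R e + orth_proj e h)) \<partial>std_normal_vec"]) measurable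
  also have "(\<integral>\<^sup>+g. \<integral>\<^sup>+h. ennreal (S ((g \<bullet> e) *\<^sub>R e + orth_proj e h)) \<partial>std_normal_vec \<partial>std_normal_vec) = ?I"
    by (rule std_normal_vec_split[OF _ e]) measurable
  finally have "2 * (\<integral>\<^sup>+h. ennreal (S (orth_proj e h)) \<partial>std_normal_vec) \<le> 2 * ?I"
    by (simp add: mult_2)
  then show ?thesis
    by (simp add: ennreal_mult_le_mult_iff)
qed

section \<open>The support function and the projection\<close>

text \<open>The integrand of the local mean width: the support function of the set of differences of
  points of \<open>K\<close> at distance at most \<open>t\<close>.\<close>

definition local_support :: "'a::real_inner set \<Rightarrow> real \<Rightarrow> 'a \<Rightarrow> real" where
  "local_support K t g = Sup {g \<bullet> (u - v) | u v. u \<in> K \<and> v \<in> K \<and> norm (u - v) \<le> t}"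

context
  fixes K :: "'a::real_inner set" and t :: real
  assumes nonempty: "K \<noteq> {}" and t: "0 \<le> t"
begin

lemma local_support_bdd:
  "bdd_above {g \<bullet> (u - v) | u v. u \<in> K \<and> v \<in> K \<and> norm (u - v) \<le> t}"
proof (rule bdd_aboveI)
  fix r assume "r \<in> {g \<bullet> (u - v) | u v. u \<in> K \<and> v \<in> K \<and> norm (u - v) \<le> t}"
  then obtain d where "r = g \<bullet> d" "norm d \<le> t" by blast
  then show "r \<le> norm g * t"
    by (metis norm_cauchy_schwarz mult_left_mono norm_ge_zero order_trans)
qed

lemma local_support_upper:
  assumes "u \<in> K" "v \<in> K" "norm (u - v) \<le> t"
  shows "g \<bullet> (u - v) \<le> local_support K t g"
  unfolding local_support_def by (rule cSup_upper[OF _ local_support_bdd]) (use assms in blast)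

lemma local_support_least:
  assumes "\<And>u v. u \<in> K \<Longrightarrow> v \<in> K \<Longrightarrow> norm (u - v) \<le> t \<Longrightarrow> g \<bullet> (u - v) \<le> r"
  shows "local_support K t g \<le> r"
proof -
  obtain p where "p \<in> K" using nonempty by blast
  then have "g \<bullet> (p - p) \<in> {g \<bullet> (u - v) | u v. u \<in> K \<and> v \<in> K \<and> norm (u - v) \<le> t}"
    using t by fastforce
  then show ?thesis
    unfolding local_support_def by (intro cSup_least) (use assms in blast)+
qed

lemma local_support_nonneg: "0 \<le> local_support K t g"
proof -
  obtain p where "p \<in> K" using nonempty by blast
  then show ?thesis using local_support_upper[of p p g] t by simp
qed

lemma local_support_le_norm: "local_support K t g \<le> t * norm g"
proof (rule local_support_least)
  fix u v :: 'a assume "norm (u - v) \<le> t"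
  then show "g \<bullet> (u - v) \<le> t * norm g"
    by (metis norm_cauchy_schwarz mult.commute mult_left_mono norm_ge_zero order_trans)
qed

lemma local_support_add: "local_support K t (g + h) \<le> local_support K t g + local_support K t h"
  by (rule local_support_least) (simp add: inner_add_left add_mono local_support_upper)

lemma local_support_scaleR:
  assumes "0 \<le> c"
  shows "local_support K t (c *\<^sub>R g) = c * local_support K t g"
proof (rule antisym)
  show le: "local_support K t (c *\<^sub>R g) \<le> c * local_support K t g"
    using assms by (intro local_support_least) (simp add: local_support_upper mult_left_mono)
  show "c * local_support K t g \<le> local_support K t (c *\<^sub>R g)"
  proof (cases "c = 0")
    case False
    then have c: "c > 0" using assms by simp
    have "local_support K t g \<le> local_support K t (c *\<^sub>R g) / c"
    proof (rule local_support_least)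
      fix u v assume "u \<in> K" "v \<in> K" "norm (u - v) \<le> t"
      from local_support_upper[OF this, of "c *\<^sub>R g"] c
      show "g \<bullet> (u - v) \<le> local_support K t (c *\<^sub>R g) / c" by (simp add: field_simps)
    qed
    then show ?thesis using c by (simp add: field_simps)
  qed (simp add: local_support_nonneg)
qed

lemma continuous_on_local_support: "continuous_on UNIV (local_support K t)"
proof -
  have "t-lipschitz_on UNIV (local_support K t)"
  proof (rule lipschitz_onI)
    fix g h :: 'a
    have "local_support K t g \<le> local_support K t h + t * norm (g - h)" for g h
      using local_support_add[of "g - h" h] local_support_le_norm[of "g - h"] by simp
    from this[of g h] this[of h g]
    show "dist (local_support K t g) (local_support K t h) \<le> t * dist g h"
      by (simp add: dist_norm norm_minus_commute)
  qed (rule t)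
  then show ?thesis by (rule lipschitz_on_continuous_on)
qed

end

lemma local_support_measurable:
  fixes K :: "'a::euclidean_space set"
  assumes "K \<noteq> {}" "0 \<le> t"
  shows "local_support K t \<in> borel_measurable borel"
  by (rule borel_measurable_continuous_onI) (rule continuous_on_local_support[OF assms])

lemma nn_integral_local_support:
  fixes K :: "(real ^ 'n) set"
  assumes "K \<noteq> {}" "0 \<le> t"
  shows "(\<integral>\<^sup>+g. ennreal (local_support K t g) \<partial>std_normal_vec) = ennreal (local_mean_width K t)"
    and "0 \<le> local_mean_width K t"
proof -
  have eq: "local_mean_width K t = (\<integral>g. local_support K t g \<partial>std_normal_vec)"
    by (simp add: local_mean_width_def local_support_def)
  have "integrable std_normal_vec (local_support K t)"
  proof (rule Bochner_Integration.integrable_bound)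
    show "integrable std_normal_vec (\<lambda>g :: real ^ 'n. t * norm g)"
      by (intro integrable_mult_right integrable_norm_std_normal_vec)
    show "local_support K t \<in> borel_measurable std_normal_vec"
      using local_support_measurable[OF assms] by simp
    show "AE g in std_normal_vec. norm (local_support K t g) \<le> norm (t * norm g)"
      using local_support_nonneg[OF assms] local_support_le_norm[OF assms] assms by auto
  qed
  then show "(\<integral>\<^sup>+g. ennreal (local_support K t g) \<partial>std_normal_vec) = ennreal (local_mean_width K t)"
    unfolding eq by (rule nn_integral_eq_integral) (simp add: local_support_nonneg[OF assms])
  show "0 \<le> local_mean_width K t"
    unfolding eq by (simp add: local_support_nonneg[OF assms])
qed

text \<open>Minimality of the projection bounds the squared length of the error \<open>h = z - p\<close> by
  \<open>2 * (h \<bullet> (w - p))\<close>. A long error can be rescaled to length \<open>t\<close> inside the differences of \<open>K\<close>,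
  which turns this into a linear bound on its length; a short one is covered by the summand
  \<open>t\<close>.\<close>

lemma metric_projection_error_le:
  fixes K :: "'a::real_inner set"
  assumes star: "star_shaped K" and p: "p \<in> K" and z: "z \<in> metric_projections K w" and t: "0 < t"
  shows "norm (z - p) \<le> t + 2 / t * local_support K t (w - p)"
proof -
  have ne: "K \<noteq> {}" using p by blast
  have zK: "z \<in> K" and zmin: "\<not> norm (w - p) < norm (w - z)"
    using z p by (auto simp: metric_projections_def is_arg_min_def)
  let ?d = "norm (z - p)"
  show ?thesis
  proof (cases "?d \<le> t")
    case True
    then show ?thesis using local_support_nonneg[OF ne, of t "w - p"] t
      by (simp add: add_increasing2)
  next
    case False
    then have d: "?d > 0" "t \<le> ?d" using t by auto
    have "(norm (w - z))\<^sup>2 \<le> (norm (w - p))\<^sup>2" using zmin by (simp add: power_mono)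
    moreover have "(norm (w - z))\<^sup>2 = (norm (w - p))\<^sup>2 - 2 * ((w - p) \<bullet> (z - p)) + ?d\<^sup>2"
      unfolding power2_norm_eq_inner by (simp add: algebra_simps inner_commute)
    ultimately have basic: "?d\<^sup>2 \<le> 2 * ((w - p) \<bullet> (z - p))" by simp
    \<comment> \<open>Star-shapedness shrinks the pair to distance \<open>t\<close>, where the support function controls it.\<close>
    have scaled: "(t / ?d) *\<^sub>R v \<in> K" if "v \<in> K" for v
      using star that d t unfolding star_shaped_def by (auto simp: image_subset_iff)
    have "norm ((t / ?d) *\<^sub>R z - (t / ?d) *\<^sub>R p) \<le> t"
      using d t by (simp add: scaleR_diff_right[symmetric])
    from local_support_upper[OF ne _ scaled[OF zK] scaled[OF p] this, of "w - p"] t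
    have "t / ?d * ((w - p) \<bullet> (z - p)) \<le> local_support K t (w - p)"
      by (simp add: scaleR_diff_right[symmetric])
    moreover have "?d \<le> 2 / t * (t / ?d * ((w - p) \<bullet> (z - p)))"
      using basic d t by (simp add: field_simps power2_eq_square)
    ultimately have "?d \<le> 2 / t * local_support K t (w - p)"
      using t by (meson divide_nonneg_pos mult_left_mono order_trans zero_le_numeral)
    then show ?thesis using t by simp
  qed
qed

section \<open>Independence of the responses and the orthogonal components\<close>

text \<open>Independence of random elements with values in different types is expressed as a
  factorisation of their joint law.\<close>

lemma (in prob_space) nn_integral_product_law:
  assumes [measurable]: "X \<in> measurable M S" "Y \<in> measurable M T"
    and law: "distr M (S \<Otimes>\<^sub>M T) (\<lambda>\<omega>. (X \<omega>, Y \<omega>)) = distr M S X \<Otimes>\<^sub>M distr M T Y"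
    and [measurable]: "case_prod H \<in> borel_measurable (S \<Otimes>\<^sub>M T)"
  shows "(\<integral>\<^sup>+\<omega>. H (X \<omega>) (Y \<omega>) \<partial>M) = (\<integral>\<^sup>+\<omega>. \<integral>\<^sup>+\<omega>'. H (X \<omega>) (Y \<omega>') \<partial>M \<partial>M)"
proof -
  interpret Y: prob_space "distr M T Y" by (rule prob_space_distr) measurable
  have "(\<integral>\<^sup>+\<omega>. H (X \<omega>) (Y \<omega>) \<partial>M) = (\<integral>\<^sup>+z. case_prod H z \<partial>distr M (S \<Otimes>\<^sub>M T) (\<lambda>\<omega>. (X \<omega>, Y \<omega>)))"
    by (simp add: nn_integral_distr)
  also have "\<dots> = (\<integral>\<^sup>+x. \<integral>\<^sup>+y. H x y \<partial>distr M T Y \<partial>distr M S X)"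
    unfolding law by (subst Y.nn_integral_fst[symmetric]) auto
  also have "\<dots> = (\<integral>\<^sup>+\<omega>. \<integral>\<^sup>+y. H (X \<omega>) y \<partial>distr M T Y \<partial>M)"
    by (simp add: nn_integral_distr)
  also have "\<dots> = (\<integral>\<^sup>+\<omega>. \<integral>\<^sup>+\<omega>'. H (X \<omega>) (Y \<omega>') \<partial>M \<partial>M)"
  proof (rule nn_integral_cong)
    fix \<omega> assume "\<omega> \<in> space M"
    then have [measurable]: "X \<omega> \<in> space S" by (rule measurable_space[OF assms(1)])
    show "(\<integral>\<^sup>+y. H (X \<omega>) y \<partial>distr M T Y) = (\<integral>\<^sup>+\<omega>'. H (X \<omega>) (Y \<omega>') \<partial>M)"
      by (rule nn_integral_distr) measurable
  qed
  finally show ?thesis .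
qed

lemma (in prob_space) indep_var_nn_integral_pair:
  assumes indep: "indep_var S X T Y"
    and "case_prod H \<in> borel_measurable (S \<Otimes>\<^sub>M T)"
  shows "(\<integral>\<^sup>+\<omega>. H (X \<omega>) (Y \<omega>) \<partial>M) = (\<integral>\<^sup>+\<omega>. \<integral>\<^sup>+\<omega>'. H (X \<omega>) (Y \<omega>') \<partial>M \<partial>M)"
  using indep unfolding indep_var_distribution_eq
  by (intro nn_integral_product_law[of X S Y T H] assms) auto

lemma (in prob_space) product_lawI:
  assumes [measurable]: "X \<in> measurable M S" "Y \<in> measurable M T"
    and prod: "\<And>A B. A \<in> sets S \<Longrightarrow> B \<in> sets T \<Longrightarrow>
      prob ((X -` A \<inter> space M) \<inter> (Y -` B \<inter> space M)) = prob (X -` A \<inter> space M) * prob (Y -` B \<inter> space M)"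
  shows "distr M (S \<Otimes>\<^sub>M T) (\<lambda>\<omega>. (X \<omega>, Y \<omega>)) = distr M S X \<Otimes>\<^sub>M distr M T Y"
proof (rule pair_measure_eqI[symmetric])
  interpret X: prob_space "distr M S X" by (rule prob_space_distr) measurable
  interpret Y: prob_space "distr M T Y" by (rule prob_space_distr) measurable
  show "sigma_finite_measure (distr M S X)" "sigma_finite_measure (distr M T Y)"
    by (rule X.sigma_finite_measure_axioms Y.sigma_finite_measure_axioms)+
  fix A B assume "A \<in> sets (distr M S X)" "B \<in> sets (distr M T Y)"
  then have AB[measurable]: "A \<in> sets S" "B \<in> sets T" by auto
  have "(\<lambda>\<omega>. (X \<omega>, Y \<omega>)) -` (A \<times> B) \<inter> space M = (X -` A \<inter> space M) \<inter> (Y -` B \<inter> space M)" by auto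
  then show "emeasure (distr M S X) A * emeasure (distr M T Y) B
    = emeasure (distr M (S \<Otimes>\<^sub>M T) (\<lambda>\<omega>. (X \<omega>, Y \<omega>))) (A \<times> B)"
    using prod[OF AB] by (simp add: emeasure_distr emeasure_eq_measure ennreal_mult')
qed simp

text \<open>If \<open>f Y\<close> is independent of \<open>Z\<close>, then its conditional probabilities given \<open>Z\<close> are constants.
  Integrating the conditional factorisation for \<open>X\<close> and \<open>f Y\<close> then removes the conditioning.\<close>

lemma (in prob_space) cond_indep_imp_product_law:
  assumes ci: "cond_indep_var_given M S X T Y R Z"
    and [measurable]: "X \<in> measurable M S" "Y \<in> measurable M T" "Z \<in> measurable M R" "f \<in> measurable T T'"
    and ind: "\<And>C B. C \<in> sets R \<Longrightarrow> B \<in> sets T' \<Longrightarrow>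
      prob ((Z -` C \<inter> space M) \<inter> ((\<lambda>\<omega>. f (Y \<omega>)) -` B \<inter> space M))
        = prob (Z -` C \<inter> space M) * prob ((\<lambda>\<omega>. f (Y \<omega>)) -` B \<inter> space M)"
  shows "distr M (S \<Otimes>\<^sub>M T') (\<lambda>\<omega>. (X \<omega>, f (Y \<omega>))) = distr M S X \<Otimes>\<^sub>M distr M T' (\<lambda>\<omega>. f (Y \<omega>))"
proof (rule product_lawI)
  fix A B assume A[measurable]: "A \<in> sets S" and B[measurable]: "B \<in> sets T'"
  let ?F = "vimage_algebra (space M) Z R"
  let ?E = "X -` A \<inter> space M" and ?G = "(\<lambda>\<omega>. f (Y \<omega>)) -` B \<inter> space M"
  have sub: "subalgebra M ?F"
    unfolding subalgebra_def
    by (intro conjI sets_image_in_sets) simp_all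
  interpret F: finite_measure_subalgebra M ?F
    by unfold_locales (rule sub)
  have [measurable]: "?E \<in> sets M" "?G \<in> sets M" by measurable
  have G: "?G = Y -` (f -` B \<inter> space T) \<inter> space M"
    using measurable_space[OF \<open>Y \<in> measurable M T\<close>] by auto
  have int: "integrable M (indicator C :: 'a \<Rightarrow> real)" if "C \<in> sets M" for C
    using that by (simp add: integrable_indicator_iff emeasure_eq_measure)
  have const: "AE \<omega> in M. real_cond_exp M ?F (indicator ?G) \<omega> = prob ?G"
  proof (rule F.real_cond_exp_charact)
    fix C assume "C \<in> sets ?F"
    then obtain D where D[measurable]: "D \<in> sets R" and C: "C = Z -` D \<inter> space M"
      using sets_vimage_algebra2[of Z "space M" R] measurable_space[OF assms(4)] by auto
    have [measurable]: "C \<in> sets M" unfolding C by measurable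
    have "(LINT \<omega>:C|M. indicator ?G \<omega>) = prob (C \<inter> ?G)"
      by (simp add: set_lebesgue_integral_def indicator_inter_arith[symmetric])
    also have "\<dots> = prob C * prob ?G"
      unfolding C by (rule ind) measurable
    also have "\<dots> = (LINT \<omega>:C|M. prob ?G)"
      by (simp add: set_lebesgue_integral_def)
    finally show "(LINT \<omega>:C|M. indicator ?G \<omega>) = (LINT \<omega>:C|M. prob ?G)" .
  qed (auto simp: int)
  have fB: "f -` B \<inter> space T \<in> sets T" by measurable
  have "AE \<omega> in M. real_cond_exp M ?F (indicator (?E \<inter> ?G)) \<omega>
      = real_cond_exp M ?F (indicator ?E) \<omega> * real_cond_exp M ?F (indicator ?G) \<omega>"
    using ci A fB unfolding cond_indep_var_given_def G by blast
  with const have ae: "AE \<omega> in M. real_cond_exp M ?F (indicator (?E \<inter> ?G)) \<omega> = real_cond_exp M ?F (indicator ?E) \<omega> * prob ?G"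
    by eventually_elim simp
  have "prob (?E \<inter> ?G) = (\<integral>\<omega>. real_cond_exp M ?F (indicator (?E \<inter> ?G)) \<omega> \<partial>M)"
    by (subst F.real_cond_exp_int(2)) (auto simp: int)
  also have "\<dots> = (\<integral>\<omega>. real_cond_exp M ?F (indicator ?E) \<omega> * prob ?G \<partial>M)"
    by (rule integral_cong_AE) (use ae in auto)
  also have "\<dots> = prob ?E * prob ?G"
    by (simp add: F.real_cond_exp_int(2) int)
  finally show "prob (?E \<inter> ?G) = prob ?E * prob ?G" .
qed measurable

text \<open>As \<open>x\<close> is a multiple of \<open>e\<close>, the conditioning variable \<open>a \<bullet> x\<close> is a function of the component
  of \<open>a\<close> along \<open>e\<close> and so independent of the orthogonal component.\<close>

lemma (in prob_space) normal_vec_orth_proj_indep_response: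
  fixes a :: "'a \<Rightarrow> real ^ 'n" and y :: "'a \<Rightarrow> real" and e x :: "real ^ 'n"
  assumes law: "distributed M lborel a (\<lambda>z. ennreal (std_normal_vec_density z))"
    and ci: "cond_indep_var_given M borel y borel a borel (\<lambda>\<omega>. a \<omega> \<bullet> x)"
    and y[measurable]: "y \<in> borel_measurable M"
    and x: "x = r *\<^sub>R e" and e: "norm e = 1"
    and [measurable]: "case_prod H \<in> borel_measurable (borel \<Otimes>\<^sub>M borel)"
  shows "(\<integral>\<^sup>+\<omega>. H (y \<omega>) (orth_proj e (a \<omega>)) \<partial>M)
       = (\<integral>\<^sup>+\<omega>. \<integral>\<^sup>+h. H (y \<omega>) (orth_proj e h) \<partial>std_normal_vec \<partial>M)"
proof -
  have a[measurable]: "a \<in> borel_measurable M"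
    and distr: "distr M lborel a = std_normal_vec"
    using law by (auto simp: distributed_def std_normal_vec_def)
  have E: "(\<integral>\<^sup>+\<omega>. F (a \<omega>) \<partial>M) = (\<integral>\<^sup>+g. F g \<partial>std_normal_vec)" if [measurable]: "F \<in> borel_measurable borel" for F
    unfolding distr[symmetric] by (subst nn_integral_distr) auto
  have "distr M (borel \<Otimes>\<^sub>M borel) (\<lambda>\<omega>. (y \<omega>, orth_proj e (a \<omega>)))
      = distr M borel y \<Otimes>\<^sub>M distr M borel (\<lambda>\<omega>. orth_proj e (a \<omega>))"
  proof (rule cond_indep_imp_product_law[OF ci])
    fix A :: "real set" and B :: "(real ^ 'n) set"
    assume [measurable]: "A \<in> sets borel" "B \<in> sets borel"
    let ?N = "std_normal_vec :: (real ^ 'n) measure"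
    let ?A = "{g. r * (g \<bullet> e) \<in> A}" and ?B = "{g. orth_proj e g \<in> B}"
    have [measurable]: "?A \<in> sets borel" "?B \<in> sets borel" by measurable
    have "emeasure ?N (?A \<inter> ?B) = (\<integral>\<^sup>+g. indicator (?A \<inter> ?B) g \<partial>?N)"
      by (rule nn_integral_indicator[symmetric]) simp
    also have "\<dots> = (\<integral>\<^sup>+g. indicator {s. r * s \<in> A} (g \<bullet> e) * indicator B (orth_proj e g) \<partial>?N)"
      by (intro nn_integral_cong) (auto simp: indicator_def)
    also have "\<dots> = (\<integral>\<^sup>+g. \<integral>\<^sup>+h. indicator {s. r * s \<in> A} (g \<bullet> e) * indicator B (orth_proj e h) \<partial>?N \<partial>?N)"
      by (rule std_normal_vec_indep_orth_proj[of "\<lambda>s v. indicator {s. r * s \<in> A} s * indicator B v", OF _ e]) measurable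
    also have "\<dots> = (\<integral>\<^sup>+g. \<integral>\<^sup>+h. indicator ?A g * indicator ?B h \<partial>?N \<partial>?N)"
      by (intro nn_integral_cong) (auto simp: indicator_def)
    also have "\<dots> = emeasure ?N ?A * emeasure ?N ?B"
      by (simp add: nn_integral_cmult nn_integral_multc)
    finally have N: "emeasure ?N (?A \<inter> ?B) = emeasure ?N ?A * emeasure ?N ?B" .
    have pre: "emeasure ?N D = ennreal (prob (a -` D \<inter> space M))" if "D \<in> sets borel" for D
      unfolding distr[symmetric] using that by (simp add: emeasure_distr emeasure_eq_measure)
    have "prob (a -` (?A \<inter> ?B) \<inter> space M) = prob (a -` ?A \<inter> space M) * prob (a -` ?B \<inter> space M)"
      using N by (simp add: pre ennreal_mult'[symmetric])
    moreover have "a -` ?A \<inter> space M = (\<lambda>\<omega>. a \<omega> \<bullet> x) -` A \<inter> space M"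
      "a -` ?B \<inter> space M = (\<lambda>\<omega>. orth_proj e (a \<omega>)) -` B \<inter> space M"
      "a -` (?A \<inter> ?B) \<inter> space M = ((\<lambda>\<omega>. a \<omega> \<bullet> x) -` A \<inter> space M) \<inter> ((\<lambda>\<omega>. orth_proj e (a \<omega>)) -` B \<inter> space M)"
      by (auto simp: x)
    ultimately show "prob (((\<lambda>\<omega>. a \<omega> \<bullet> x) -` A \<inter> space M) \<inter> ((\<lambda>\<omega>. orth_proj e (a \<omega>)) -` B \<inter> space M))
        = prob ((\<lambda>\<omega>. a \<omega> \<bullet> x) -` A \<inter> space M) * prob ((\<lambda>\<omega>. orth_proj e (a \<omega>)) -` B \<inter> space M)"
      by simp
  qed measurable
  then have "(\<integral>\<^sup>+\<omega>. H (y \<omega>) (orth_proj e (a \<omega>)) \<partial>M) = (\<integral>\<^sup>+\<omega>. \<integral>\<^sup>+\<omega>'. H (y \<omega>) (orth_proj e (a \<omega>')) \<partial>M \<partial>M)"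
    by (intro nn_integral_product_law[of y borel "\<lambda>\<omega>. orth_proj e (a \<omega>)" borel H]) auto
  also have "\<dots> = (\<integral>\<^sup>+\<omega>. \<integral>\<^sup>+h. H (y \<omega>) (orth_proj e h) \<partial>std_normal_vec \<partial>M)"
    by (intro nn_integral_cong E) measurable
  finally show ?thesis .
qed

text \<open>Joint law of the weighted sum of the orthogonal components and of the squared norm of the
  response vector: the sum behaves like one Gaussian vector, independent of the responses,
  scaled by that norm. The squared norm is carried along because the induction adds the
  next summand to a Gaussian of scale \<open>sqrt Q\<close>: with independent standard normal \<open>g\<close> and
  \<open>h\<close>, the vector \<open>sqrt Q * g + z * h\<close> has scale \<open>sqrt (Q + z\<^sup>2)\<close>.\<close>

lemma (in prob_space) sum_response_orth_proj_law:
  fixes a :: "nat \<Rightarrow> 'a \<Rightarrow> real ^ 'n" and y :: "nat \<Rightarrow> 'a \<Rightarrow> real" and e x :: "real ^ 'n"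
  assumes law: "\<And>i. i \<in> {1..m} \<Longrightarrow> distributed M lborel (a i) (\<lambda>z. ennreal (std_normal_vec_density z))"
    and ci: "\<And>i. i \<in> {1..m} \<Longrightarrow> cond_indep_var_given M borel (y i) borel (a i) borel (\<lambda>\<omega>. a i \<omega> \<bullet> x)"
    and indep: "indep_vars (\<lambda>_. borel \<Otimes>\<^sub>M borel) (\<lambda>i \<omega>. (a i \<omega>, y i \<omega>)) {1..m}"
    and x: "x = r *\<^sub>R e" and e: "norm e = 1"
    and k: "k \<le> m"
    and G: "case_prod G \<in> borel_measurable (borel \<Otimes>\<^sub>M borel)"
  shows "(\<integral>\<^sup>+\<omega>. G (\<Sum>i=1..k. y i \<omega> *\<^sub>R orth_proj e (a i \<omega>)) (\<Sum>i=1..k. (y i \<omega>)\<^sup>2) \<partial>M)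
       = (\<integral>\<^sup>+\<omega>. \<integral>\<^sup>+g. G (sqrt (\<Sum>i=1..k. (y i \<omega>)\<^sup>2) *\<^sub>R orth_proj e g) (\<Sum>i=1..k. (y i \<omega>)\<^sup>2) \<partial>std_normal_vec \<partial>M)"
  using k G
proof (induction k arbitrary: G)
  case 0
  interpret N: prob_space "std_normal_vec :: (real ^ 'n) measure" by (rule prob_space_std_normal_vec)
  show ?case using N.emeasure_space_1 by simp
next
  case (Suc k)
  note [measurable] = Suc.prems(2)
  interpret N: prob_space "std_normal_vec :: (real ^ 'n) measure" by (rule prob_space_std_normal_vec)
  interpret NM: pair_sigma_finite M "std_normal_vec :: (real ^ 'n) measure" ..
  interpret MM: pair_sigma_finite M M ..
  have pair: "(\<lambda>\<omega>. (a i \<omega>, y i \<omega>)) \<in> measurable M (borel \<Otimes>\<^sub>M borel)" if "i \<in> {1..m}" for i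
    using indep that by (auto simp: indep_vars_def)
  have ai: "a i \<in> borel_measurable M" and yi: "y i \<in> borel_measurable M" if "i \<in> {1..m}" for i
    using measurable_fst'[OF pair[OF that]] measurable_snd'[OF pair[OF that]] by simp_all
  define b where "b = a (Suc k)"
  define z where "z = y (Suc k)"
  define X where "X \<omega> = (\<Sum>i=1..k. y i \<omega> *\<^sub>R orth_proj e (a i \<omega>))" for \<omega>
  define Q where "Q \<omega> = (\<Sum>i=1..k. (y i \<omega>)\<^sup>2)" for \<omega>
  have Sk: "Suc k \<in> {1..m}" using Suc.prems(1) by simp
  have [measurable]: "b \<in> borel_measurable M" "z \<in> borel_measurable M"
    using ai[OF Sk] yi[OF Sk] by (simp_all add: b_def z_def)
  have [measurable]: "X \<in> borel_measurable M"
    unfolding X_def using Suc.prems(1)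
    by (intro borel_measurable_sum borel_measurable_scaleR yi measurable_compose[OF ai orth_proj_measurable]) auto
  have [measurable]: "Q \<in> borel_measurable M"
    unfolding Q_def using Suc.prems(1)
    by (intro borel_measurable_sum borel_measurable_power yi) auto
  have Q0: "0 \<le> Q \<omega>" for \<omega> by (simp add: Q_def sum_nonneg)
  have indXb: "indep_var (borel \<Otimes>\<^sub>M borel) (\<lambda>\<omega>. (X \<omega>, Q \<omega>)) (borel \<Otimes>\<^sub>M borel) (\<lambda>\<omega>. (b \<omega>, z \<omega>))"
  proof -
    let ?P = "borel \<Otimes>\<^sub>M borel :: ((real ^ 'n) \<times> real) measure"
    let ?f = "\<lambda>F :: nat \<Rightarrow> (real ^ 'n) \<times> real. (\<Sum>i=1..k. snd (F i) *\<^sub>R orth_proj e (fst (F i)), \<Sum>i=1..k. (snd (F i))\<^sup>2)"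
    have comp: "(\<lambda>F. F i) \<in> measurable (PiM {1..k} (\<lambda>_. ?P)) ?P" if "i \<in> {1..k}" for i
      using that by simp
    have f: "?f \<in> measurable (PiM {1..k} (\<lambda>_. ?P)) ?P"
      by (intro measurable_Pair borel_measurable_sum borel_measurable_scaleR borel_measurable_power
            measurable_compose[OF _ orth_proj_measurable] measurable_fst'[OF comp] measurable_snd'[OF comp])
    have "indep_var ?P (?f \<circ> (\<lambda>\<omega>. restrict (\<lambda>i. (a i \<omega>, y i \<omega>)) {1..k})) ?P
            ((\<lambda>F. F (Suc k)) \<circ> (\<lambda>\<omega>. restrict (\<lambda>i. (a i \<omega>, y i \<omega>)) {Suc k}))"
      by (rule indep_var_compose[OF indep_var_restrict[OF indep]])
         (use Suc.prems(1) f in auto)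
    moreover have "?f \<circ> (\<lambda>\<omega>. restrict (\<lambda>i. (a i \<omega>, y i \<omega>)) {1..k}) = (\<lambda>\<omega>. (X \<omega>, Q \<omega>))"
      by (simp add: fun_eq_iff X_def Q_def)
    moreover have "(\<lambda>F. F (Suc k)) \<circ> (\<lambda>\<omega>. restrict (\<lambda>i. (a i \<omega>, y i \<omega>)) {Suc k}) = (\<lambda>\<omega>. (b \<omega>, z \<omega>))"
      by (simp add: fun_eq_iff b_def z_def)
    ultimately show ?thesis by simp
  qed
  have indQz: "indep_var borel Q borel z"
    using indep_var_compose[OF indXb, of snd borel snd borel] by (simp add: comp_def)
  have last: "(\<integral>\<^sup>+\<omega>. H (z \<omega>) (orth_proj e (b \<omega>)) \<partial>M) = (\<integral>\<^sup>+\<omega>. \<integral>\<^sup>+h. H (z \<omega>) (orth_proj e h) \<partial>std_normal_vec \<partial>M)"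
    if "case_prod H \<in> borel_measurable (borel \<Otimes>\<^sub>M borel)" for H
    unfolding b_def z_def
    by (rule normal_vec_orth_proj_indep_response[OF law[OF Sk] ci[OF Sk] yi[OF Sk] x e that])
  have IH: "(\<integral>\<^sup>+\<omega>. H (X \<omega>) (Q \<omega>) \<partial>M) = (\<integral>\<^sup>+\<omega>. \<integral>\<^sup>+g. H (sqrt (Q \<omega>) *\<^sub>R orth_proj e g) (Q \<omega>) \<partial>std_normal_vec \<partial>M)"
    if "case_prod H \<in> borel_measurable (borel \<Otimes>\<^sub>M borel)" for H
    unfolding X_def Q_def by (rule Suc.IH) (use Suc.prems(1) that in auto)
  \<comment> \<open>Decouple the new pair from the earlier ones, replace its Gaussian component and then the
    partial sum by independent Gaussians, combine the two, and couple the responses again.\<close>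
  have "(\<integral>\<^sup>+\<omega>. G (X \<omega> + z \<omega> *\<^sub>R orth_proj e (b \<omega>)) (Q \<omega> + (z \<omega>)\<^sup>2) \<partial>M)
      = (\<integral>\<^sup>+\<omega>. \<integral>\<^sup>+\<omega>'. G (X \<omega> + z \<omega>' *\<^sub>R orth_proj e (b \<omega>')) (Q \<omega> + (z \<omega>')\<^sup>2) \<partial>M \<partial>M)"
    using indep_var_nn_integral_pair[OF indXb,
        of "\<lambda>p q. G (fst p + snd q *\<^sub>R orth_proj e (fst q)) (snd p + (snd q)\<^sup>2)"]
    by simp
  also have "\<dots> = (\<integral>\<^sup>+\<omega>. \<integral>\<^sup>+\<omega>'. \<integral>\<^sup>+h. G (X \<omega> + z \<omega>' *\<^sub>R orth_proj e h) (Q \<omega> + (z \<omega>')\<^sup>2) \<partial>std_normal_vec \<partial>M \<partial>M)"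
    by (intro nn_integral_cong last) measurable
  also have "\<dots> = (\<integral>\<^sup>+\<omega>. \<integral>\<^sup>+g. \<integral>\<^sup>+\<omega>'. \<integral>\<^sup>+h. G (sqrt (Q \<omega>) *\<^sub>R orth_proj e g + z \<omega>' *\<^sub>R orth_proj e h) (Q \<omega> + (z \<omega>')\<^sup>2) \<partial>std_normal_vec \<partial>M \<partial>std_normal_vec \<partial>M)"
    by (rule IH[of "\<lambda>X Q. \<integral>\<^sup>+\<omega>'. \<integral>\<^sup>+h. G (X + z \<omega>' *\<^sub>R orth_proj e h) (Q + (z \<omega>')\<^sup>2) \<partial>std_normal_vec \<partial>M"]) measurable
  also have "\<dots> = (\<integral>\<^sup>+\<omega>. \<integral>\<^sup>+\<omega>'. \<integral>\<^sup>+g. \<integral>\<^sup>+h. G (sqrt (Q \<omega>) *\<^sub>R orth_proj e g + z \<omega>' *\<^sub>R orth_proj e h) (Q \<omega> + (z \<omega>')\<^sup>2) \<partial>std_normal_vec \<partial>std_normal_vec \<partial>M \<partial>M)"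
    by (intro nn_integral_cong NM.Fubini') measurable
  also have "\<dots> = (\<integral>\<^sup>+\<omega>. \<integral>\<^sup>+\<omega>'. \<integral>\<^sup>+g. G (sqrt (Q \<omega> + (z \<omega>')\<^sup>2) *\<^sub>R orth_proj e g) (Q \<omega> + (z \<omega>')\<^sup>2) \<partial>std_normal_vec \<partial>M \<partial>M)"
  proof (rule nn_integral_cong, rule nn_integral_cong)
    fix \<omega> \<omega>'
    have lin: "c *\<^sub>R orth_proj e g + d *\<^sub>R orth_proj e h = orth_proj e (c *\<^sub>R g + d *\<^sub>R h)"
      and lin': "c *\<^sub>R orth_proj e g = orth_proj e (c *\<^sub>R g)" for c d g h
      using linear_orth_proj[of e] by (simp_all add: linear_add linear_cmul)
    show "(\<integral>\<^sup>+g. \<integral>\<^sup>+h. G (sqrt (Q \<omega>) *\<^sub>R orth_proj e g + z \<omega>' *\<^sub>R orth_proj e h) (Q \<omega> + (z \<omega>')\<^sup>2) \<partial>std_normal_vec \<partial>std_normal_vec)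
        = (\<integral>\<^sup>+g. G (sqrt (Q \<omega> + (z \<omega>')\<^sup>2) *\<^sub>R orth_proj e g) (Q \<omega> + (z \<omega>')\<^sup>2) \<partial>std_normal_vec)"
      unfolding lin unfolding lin'
      using std_normal_vec_linear_combination[of "\<lambda>v. G (orth_proj e v) (Q \<omega> + (z \<omega>')\<^sup>2)" "sqrt (Q \<omega>)" "z \<omega>'"]
      by (simp add: Q0)
  qed
  also have "\<dots> = (\<integral>\<^sup>+\<omega>. \<integral>\<^sup>+g. G (sqrt (Q \<omega> + (z \<omega>)\<^sup>2) *\<^sub>R orth_proj e g) (Q \<omega> + (z \<omega>)\<^sup>2) \<partial>std_normal_vec \<partial>M)"
    by (rule indep_var_nn_integral_pair[OF indQz, symmetric,
        of "\<lambda>Q z. \<integral>\<^sup>+g. G (sqrt (Q + z\<^sup>2) *\<^sub>R orth_proj e g) (Q + z\<^sup>2) \<partial>std_normal_vec"]) measurable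
  finally show ?case
    by (simp add: X_def Q_def b_def z_def)
qed

section \<open>Second moments\<close>

lemma (in prob_space) nn_integral_abs_le_sqrt_second_moment:
  fixes X :: "'a \<Rightarrow> real"
  assumes [measurable]: "X \<in> borel_measurable M" and sq: "integrable M (\<lambda>\<omega>. (X \<omega>)\<^sup>2)"
  shows "(\<integral>\<^sup>+\<omega>. ennreal \<bar>X \<omega>\<bar> \<partial>M) \<le> ennreal (sqrt (expectation (\<lambda>\<omega>. (X \<omega>)\<^sup>2)))"
proof -
  have int: "integrable M (\<lambda>\<omega>. \<bar>X \<omega>\<bar>)"
    by (rule square_integrable_imp_integrable) (use sq in simp_all)
  have "0 \<le> variance (\<lambda>\<omega>. \<bar>X \<omega>\<bar>)" by (rule variance_positive)
  then have "(expectation (\<lambda>\<omega>. \<bar>X \<omega>\<bar>))\<^sup>2 \<le> expectation (\<lambda>\<omega>. (X \<omega>)\<^sup>2)"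
    using int sq by (subst (asm) variance_eq) simp_all
  then have "expectation (\<lambda>\<omega>. \<bar>X \<omega>\<bar>) \<le> sqrt (expectation (\<lambda>\<omega>. (X \<omega>)\<^sup>2))"
    by (rule real_le_rsqrt)
  then show ?thesis
    using int by (simp add: nn_integral_eq_integral ennreal_leI)
qed

lemma (in prob_space) second_moment_indep_centered_sum:
  fixes X :: "nat \<Rightarrow> 'a \<Rightarrow> real"
  assumes indep: "indep_vars (\<lambda>_. borel) X {1..m}"
    and int: "\<And>i. i \<in> {1..m} \<Longrightarrow> integrable M (X i)"
    and sq: "\<And>i. i \<in> {1..m} \<Longrightarrow> integrable M (\<lambda>\<omega>. (X i \<omega>)\<^sup>2)"
    and mean: "\<And>i. i \<in> {1..m} \<Longrightarrow> expectation (X i) = 0"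
    and k: "k \<le> m"
  shows "integrable M (\<lambda>\<omega>. (\<Sum>i=1..k. X i \<omega>)\<^sup>2) \<and>
    expectation (\<lambda>\<omega>. (\<Sum>i=1..k. X i \<omega>)\<^sup>2) = (\<Sum>i=1..k. expectation (\<lambda>\<omega>. (X i \<omega>)\<^sup>2))"
  using k
proof (induction k)
  case (Suc k)
  let ?S = "\<lambda>\<omega>. \<Sum>i=1..k. X i \<omega>"
  have Sk: "Suc k \<in> {1..m}" using Suc.prems by simp
  have "indep_var borel (X (Suc k)) borel ?S"
    by (rule indep_vars_sum) (use Suc.prems in \<open>auto intro: indep_vars_subset[OF indep]\<close>)
  moreover have S: "integrable M ?S"
    by (intro Bochner_Integration.integrable_sum int) (use Suc.prems in auto)
  ultimately have "integrable M (\<lambda>\<omega>. X (Suc k) \<omega> * ?S \<omega>)" "expectation (\<lambda>\<omega>. X (Suc k) \<omega> * ?S \<omega>) = 0"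
    using int[OF Sk] mean[OF Sk] by (simp_all add: indep_var_integrable indep_var_lebesgue_integral)
  moreover have "(\<Sum>i=1..Suc k. X i \<omega>)\<^sup>2 = (?S \<omega>)\<^sup>2 + 2 * (X (Suc k) \<omega> * ?S \<omega>) + (X (Suc k) \<omega>)\<^sup>2" for \<omega>
    by (simp add: power2_sum)
  ultimately show ?case using Suc sq[OF Sk] by simp
qed simp

lemma (in prob_space) abs_mean_deviation_le:
  fixes X :: "nat \<Rightarrow> 'a \<Rightarrow> real"
  assumes indep: "indep_vars (\<lambda>_. borel) X {1..m}" and m: "m \<ge> 1"
    and int: "\<And>i. i \<in> {1..m} \<Longrightarrow> integrable M (X i)"
    and sq: "\<And>i. i \<in> {1..m} \<Longrightarrow> integrable M (\<lambda>\<omega>. (X i \<omega>)\<^sup>2)"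
    and mean: "\<And>i. i \<in> {1..m} \<Longrightarrow> expectation (X i) = \<mu>"
    and var: "\<And>i. i \<in> {1..m} \<Longrightarrow> variance (X i) = \<sigma>\<^sup>2" and \<sigma>: "0 \<le> \<sigma>"
  shows "(\<integral>\<^sup>+\<omega>. ennreal \<bar>(1 / real m) * (\<Sum>i=1..m. X i \<omega>) - \<mu>\<bar> \<partial>M) \<le> ennreal (\<sigma> / sqrt (real m))"
proof -
  let ?Y = "\<lambda>i \<omega>. X i \<omega> - \<mu>"
  have "indep_vars (\<lambda>_. borel) ?Y {1..m}"
    using indep_vars_compose2[OF indep, of "\<lambda>_ x. x - \<mu>" "\<lambda>_. borel"] by simp
  moreover have "integrable M (\<lambda>\<omega>. (?Y i \<omega>)\<^sup>2)" if "i \<in> {1..m}" for i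
    using int[OF that] sq[OF that] by (simp add: power2_diff)
  moreover have "expectation (\<lambda>\<omega>. (?Y i \<omega>)\<^sup>2) = \<sigma>\<^sup>2" if "i \<in> {1..m}" for i
    using var[OF that] mean[OF that] by simp
  ultimately have S: "integrable M (\<lambda>\<omega>. (\<Sum>i=1..m. ?Y i \<omega>)\<^sup>2)"
      "expectation (\<lambda>\<omega>. (\<Sum>i=1..m. ?Y i \<omega>)\<^sup>2) = real m * \<sigma>\<^sup>2"
    using second_moment_indep_centered_sum[of ?Y m m] int mean by (simp_all add: prob_space)
  let ?D = "\<lambda>\<omega>. (1 / real m) * (\<Sum>i=1..m. ?Y i \<omega>)"
  have D: "(1 / real m) * (\<Sum>i=1..m. X i \<omega>) - \<mu> = ?D \<omega>" for \<omega>
    using m by (simp add: sum_subtractf field_simps)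
  have "(\<integral>\<^sup>+\<omega>. ennreal \<bar>?D \<omega>\<bar> \<partial>M) \<le> ennreal (sqrt (expectation (\<lambda>\<omega>. (?D \<omega>)\<^sup>2)))"
  proof (rule nn_integral_abs_le_sqrt_second_moment)
    show "?D \<in> borel_measurable M"
      by (intro borel_measurable_times borel_measurable_sum borel_measurable_diff borel_measurable_const
            borel_measurable_integrable int)
    show "integrable M (\<lambda>\<omega>. (?D \<omega>)\<^sup>2)"
      unfolding power_mult_distrib by (intro integrable_mult_right S)
  qed
  also have "sqrt (expectation (\<lambda>\<omega>. (?D \<omega>)\<^sup>2)) = \<sigma> / sqrt (real m)"
  proof -
    have "expectation (\<lambda>\<omega>. (?D \<omega>)\<^sup>2) = (1 / real m)\<^sup>2 * (real m * \<sigma>\<^sup>2)"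
      unfolding power_mult_distrib Bochner_Integration.integral_mult_right_zero S(2) ..
    also have "\<dots> = \<sigma>\<^sup>2 / real m" using m by (simp add: power2_eq_square)
    finally show ?thesis using \<sigma> by (simp add: real_sqrt_divide)
  qed
  finally show ?thesis unfolding D .
qed

lemma transfer_along_equal_laws:
  fixes F :: "'b \<Rightarrow> real"
  assumes "distr M N X = distr M N Y"
    and [measurable]: "X \<in> measurable M N" "Y \<in> measurable M N" "F \<in> borel_measurable N"
  shows "(\<integral>\<omega>. F (X \<omega>) \<partial>M) = (\<integral>\<omega>. F (Y \<omega>) \<partial>M)"
    and "integrable M (\<lambda>\<omega>. F (X \<omega>)) \<longleftrightarrow> integrable M (\<lambda>\<omega>. F (Y \<omega>))"
proof -
  show "(\<integral>\<omega>. F (X \<omega>) \<partial>M) = (\<integral>\<omega>. F (Y \<omega>) \<partial>M)"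
    using assms(1) integral_distr[of X M N F] integral_distr[of Y M N F] by simp
  show "integrable M (\<lambda>\<omega>. F (X \<omega>)) \<longleftrightarrow> integrable M (\<lambda>\<omega>. F (Y \<omega>))"
    using assms(1) integrable_distr_eq[of X M N F] integrable_distr_eq[of Y M N F] by simp
qed

section \<open>The error of the projected linear estimator\<close>

theorem theorem1p3:
  fixes M :: "'w measure"
    and a :: "nat \<Rightarrow> 'w \<Rightarrow> real ^ 'n"
    and y :: "nat \<Rightarrow> 'w \<Rightarrow> real"
    and x xbar :: "real ^ 'n"
    and K :: "(real ^ 'n) set"
    and xhat :: "'w \<Rightarrow> real ^ 'n"
    and m :: nat
    and \<mu> \<sigma> \<eta> t :: real
  assumes "prob_space M"
    and "m \<ge> 1"
    and "x \<noteq> 0"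
    and "xbar = (1 / norm x) *\<^sub>R x"
    and "\<And>i. i \<in> {1..m} \<Longrightarrow>
           distributed M lborel (a i) (\<lambda>z. ennreal (std_normal_vec_density z))"
    and "prob_space.indep_vars M (\<lambda>_. borel \<Otimes>\<^sub>M borel) (\<lambda>i \<omega>. (a i \<omega>, y i \<omega>)) {1..m}"
    and "\<And>i. i \<in> {1..m} \<Longrightarrow>
           distr M (borel \<Otimes>\<^sub>M borel) (\<lambda>\<omega>. (a i \<omega>, y i \<omega>)) =
           distr M (borel \<Otimes>\<^sub>M borel) (\<lambda>\<omega>. (a 1 \<omega>, y 1 \<omega>))"
    and "\<And>i. i \<in> {1..m} \<Longrightarrow>
           cond_indep_var_given M borel (y i) borel (a i) borel (\<lambda>\<omega>. a i \<omega> \<bullet> x)"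
    and "integrable M (\<lambda>\<omega>. y 1 \<omega> * (a 1 \<omega> \<bullet> xbar))"
    and "integrable M (\<lambda>\<omega>. (y 1 \<omega> * (a 1 \<omega> \<bullet> xbar))\<^sup>2)"
    and "integrable M (\<lambda>\<omega>. (y 1 \<omega>)\<^sup>2)"
    and "\<mu> = prob_space.expectation M (\<lambda>\<omega>. y 1 \<omega> * (a 1 \<omega> \<bullet> xbar))"
    and "\<sigma> \<ge> 0"
    and "\<sigma>\<^sup>2 = prob_space.variance M (\<lambda>\<omega>. y 1 \<omega> * (a 1 \<omega> \<bullet> xbar))"
    and "\<eta> \<ge> 0"
    and "\<eta>\<^sup>2 = prob_space.expectation M (\<lambda>\<omega>. (y 1 \<omega>)\<^sup>2)"
    and "star_shaped K"
    and "closed K"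
    and "\<mu> *\<^sub>R xbar \<in> K"
    and "xhat \<in> borel_measurable M"
    and "\<And>\<omega>. \<omega> \<in> space M \<Longrightarrow> xhat \<omega> \<in> metric_projections K (linear_estimator m a y \<omega>)"
    and "t > 0"
  shows "integrable M (\<lambda>\<omega>. norm (xhat \<omega> - \<mu> *\<^sub>R xbar)) \<and>
         prob_space.expectation M (\<lambda>\<omega>. norm (xhat \<omega> - \<mu> *\<^sub>R xbar)) \<le>
           t + 2 / sqrt (real m) * (\<sigma> + \<eta> * (local_mean_width K t / t))"
proof -
  interpret prob_space M by fact
  note [measurable] = \<open>xhat \<in> borel_measurable M\<close>
  let ?N = "std_normal_vec :: (real ^ 'n) measure"
  \<comment> \<open>The error of the linear estimator is \<open>D \<omega> *\<^sub>R xbar + (1 / m) *\<^sub>R R \<omega>\<close>, and given the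
    responses \<open>R\<close> is Gaussian with scale \<open>sqrt (Q \<omega>)\<close>.\<close>
  define S where "S = local_support K t"
  define \<xi> where "\<xi> i \<omega> = y i \<omega> * (a i \<omega> \<bullet> xbar)" for i \<omega>
  define Q where "Q \<omega> = (\<Sum>i=1..m. (y i \<omega>)\<^sup>2)" for \<omega>
  define R where "R \<omega> = (\<Sum>i=1..m. y i \<omega> *\<^sub>R orth_proj xbar (a i \<omega>))" for \<omega>
  define D where "D \<omega> = (1 / real m) * (\<Sum>i=1..m. \<xi> i \<omega>) - \<mu>" for \<omega>
  have m: "0 < real m" using \<open>m \<ge> 1\<close> by simp
  have e: "norm xbar = 1" and x: "x = norm x *\<^sub>R xbar"
    using \<open>x \<noteq> 0\<close> by (simp_all add: \<open>xbar = _\<close>)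
  have K: "K \<noteq> {}" and t: "0 \<le> t" using \<open>\<mu> *\<^sub>R xbar \<in> K\<close> \<open>t > 0\<close> by auto
  have S_meas[measurable]: "S \<in> borel_measurable borel"
    unfolding S_def by (rule local_support_measurable[OF K t])
  note S_nonneg = local_support_nonneg[OF K t, folded S_def]
    and S_add = local_support_add[OF K t, folded S_def]
    and S_scaleR = local_support_scaleR[OF K t, folded S_def]
    and S_le_norm = local_support_le_norm[OF K t, folded S_def]
  have pair: "(\<lambda>\<omega>. (a i \<omega>, y i \<omega>)) \<in> measurable M (borel \<Otimes>\<^sub>M borel)" if "i \<in> {1..m}" for i
    using \<open>indep_vars _ _ {1..m}\<close> that by (auto simp: indep_vars_def)
  have ai: "a i \<in> borel_measurable M" and yi: "y i \<in> borel_measurable M" if "i \<in> {1..m}" for i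
    using measurable_fst'[OF pair[OF that]] measurable_snd'[OF pair[OF that]] by simp_all
  have [measurable]: "R \<in> borel_measurable M"
    unfolding R_def
    by (intro borel_measurable_sum borel_measurable_scaleR yi measurable_compose[OF ai orth_proj_measurable])
  have [measurable]: "Q \<in> borel_measurable M"
    unfolding Q_def by (intro borel_measurable_sum borel_measurable_power yi)
  have Q0: "0 \<le> Q \<omega>" for \<omega> by (simp add: Q_def sum_nonneg)
  have \<xi>_meas: "\<xi> i \<in> borel_measurable M" if "i \<in> {1..m}" for i
    unfolding \<xi>_def using ai[OF that] yi[OF that] by measurable
  have [measurable]: "D \<in> borel_measurable M"
    unfolding D_def by (intro borel_measurable_diff borel_measurable_times borel_measurable_sum \<xi>_meas) auto

  have one: "1 \<in> {1..m}" using \<open>m \<ge> 1\<close> by simp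
  have same: "(\<integral>\<omega>. F (a i \<omega>, y i \<omega>) \<partial>M) = (\<integral>\<omega>. F (a 1 \<omega>, y 1 \<omega>) \<partial>M)"
    "integrable M (\<lambda>\<omega>. F (a i \<omega>, y i \<omega>)) \<longleftrightarrow> integrable M (\<lambda>\<omega>. F (a 1 \<omega>, y 1 \<omega>))"
    if "i \<in> {1..m}" "F \<in> borel_measurable (borel \<Otimes>\<^sub>M borel)" for i and F :: "(real ^ 'n) \<times> real \<Rightarrow> real"
    using transfer_along_equal_laws[OF assms(7)[OF that(1)] pair[OF that(1)] pair[OF one] that(2)] by auto

  have dev: "(\<integral>\<^sup>+\<omega>. ennreal \<bar>D \<omega>\<bar> \<partial>M) \<le> ennreal (\<sigma> / sqrt (real m))"
    unfolding D_def
  proof (rule abs_mean_deviation_le)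
    show "indep_vars (\<lambda>_. borel) \<xi> {1..m}"
      using indep_vars_compose2[OF \<open>indep_vars _ _ {1..m}\<close>, of "\<lambda>_ p. snd p * (fst p \<bullet> xbar)" "\<lambda>_. borel"]
      by (simp add: \<xi>_def[abs_def])
    fix i assume i: "i \<in> {1..m}"
    show "integrable M (\<xi> i)"
      using same(2)[OF i, of "\<lambda>p. snd p * (fst p \<bullet> xbar)"] assms(9) by (simp add: \<xi>_def[abs_def])
    show "integrable M (\<lambda>\<omega>. (\<xi> i \<omega>)\<^sup>2)"
      using same(2)[OF i, of "\<lambda>p. (snd p * (fst p \<bullet> xbar))\<^sup>2"] assms(10) by (simp add: \<xi>_def[abs_def])
    show mean: "expectation (\<xi> i) = \<mu>"
      using same(1)[OF i, of "\<lambda>p. snd p * (fst p \<bullet> xbar)"] assms(12) by (simp add: \<xi>_def[abs_def])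
    show "variance (\<xi> i) = \<sigma>\<^sup>2"
      unfolding mean
      using same(1)[OF i, of "\<lambda>p. (snd p * (fst p \<bullet> xbar) - \<mu>)\<^sup>2"] assms(12,14) by (simp add: \<xi>_def[abs_def])
  qed (use assms in auto)

  have sqrtQ: "(\<integral>\<^sup>+\<omega>. ennreal (sqrt (Q \<omega>)) \<partial>M) \<le> ennreal (sqrt (real m) * \<eta>)"
  proof -
    have y2: "integrable M (\<lambda>\<omega>. (y i \<omega>)\<^sup>2)" "expectation (\<lambda>\<omega>. (y i \<omega>)\<^sup>2) = \<eta>\<^sup>2" if "i \<in> {1..m}" for i
      using same[OF that, of "\<lambda>p. (snd p)\<^sup>2"] assms(11,16) by simp_all
    have "integrable M Q" unfolding Q_def by (intro Bochner_Integration.integrable_sum y2)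
    moreover have "expectation Q = real m * \<eta>\<^sup>2"
      unfolding Q_def by (subst Bochner_Integration.integral_sum) (auto simp: y2)
    ultimately show ?thesis
      using nn_integral_abs_le_sqrt_second_moment[of "\<lambda>\<omega>. sqrt (Q \<omega>)"] \<open>\<eta> \<ge> 0\<close>
      by (simp add: Q0 real_sqrt_mult)
  qed

  have fluct: "(\<integral>\<^sup>+\<omega>. ennreal (S (R \<omega>)) \<partial>M) \<le> ennreal (sqrt (real m) * \<eta> * local_mean_width K t)"
  proof -
    have "(\<integral>\<^sup>+\<omega>. ennreal (S (R \<omega>)) \<partial>M) = (\<integral>\<^sup>+\<omega>. \<integral>\<^sup>+g. ennreal (S (sqrt (Q \<omega>) *\<^sub>R orth_proj xbar g)) \<partial>?N \<partial>M)"
      unfolding R_def Q_def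
      by (rule sum_response_orth_proj_law[OF assms(5) assms(8) assms(6) x e order_refl,
            of "\<lambda>v _. ennreal (S v)"]) measurable
    also have "\<dots> = (\<integral>\<^sup>+\<omega>. ennreal (sqrt (Q \<omega>)) * (\<integral>\<^sup>+g. ennreal (S (orth_proj xbar g)) \<partial>?N) \<partial>M)"
      by (simp add: S_scaleR Q0 ennreal_mult' nn_integral_cmult)
    also have "\<dots> = (\<integral>\<^sup>+\<omega>. ennreal (sqrt (Q \<omega>)) \<partial>M) * (\<integral>\<^sup>+g. ennreal (S (orth_proj xbar g)) \<partial>?N)"
      by (rule nn_integral_multc) measurable
    also have "\<dots> \<le> ennreal (sqrt (real m) * \<eta>) * (\<integral>\<^sup>+g. ennreal (S g) \<partial>?N)"
      by (intro mult_mono sqrtQ std_normal_vec_orth_proj_sublinear_le[OF S_meas e S_nonneg S_add S_scaleR]) auto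
    also have "\<dots> = ennreal (sqrt (real m) * \<eta>) * ennreal (local_mean_width K t)"
      unfolding S_def nn_integral_local_support(1)[OF K t] ..
    also have "\<dots> = ennreal (sqrt (real m) * \<eta> * local_mean_width K t)"
      using \<open>\<eta> \<ge> 0\<close> by (simp add: ennreal_mult'[symmetric])
    finally show ?thesis .
  qed

  have pointwise: "norm (xhat \<omega> - \<mu> *\<^sub>R xbar) \<le> t + (2 * \<bar>D \<omega>\<bar> + 2 / (t * real m) * S (R \<omega>))"
    if "\<omega> \<in> space M" for \<omega>
  proof -
    have split: "linear_estimator m a y \<omega> - \<mu> *\<^sub>R xbar = D \<omega> *\<^sub>R xbar + (1 / real m) *\<^sub>R R \<omega>"
    proof -
      have "y i \<omega> *\<^sub>R a i \<omega> = \<xi> i \<omega> *\<^sub>R xbar + y i \<omega> *\<^sub>R orth_proj xbar (a i \<omega>)" for i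
        by (simp add: \<xi>_def orth_proj_def algebra_simps)
      then have "(\<Sum>i=1..m. y i \<omega> *\<^sub>R a i \<omega>) = (\<Sum>i=1..m. \<xi> i \<omega>) *\<^sub>R xbar + R \<omega>"
        by (simp add: R_def sum.distrib scaleR_sum_left)
      then show ?thesis
        by (simp add: linear_estimator_def D_def algebra_simps)
    qed
    have "S (D \<omega> *\<^sub>R xbar + (1 / real m) *\<^sub>R R \<omega>) \<le> S (D \<omega> *\<^sub>R xbar) + S ((1 / real m) *\<^sub>R R \<omega>)"
      by (rule S_add)
    also have "\<dots> \<le> t * \<bar>D \<omega>\<bar> + (1 / real m) * S (R \<omega>)"
      using S_le_norm[of "D \<omega> *\<^sub>R xbar"] S_scaleR[of "1 / real m" "R \<omega>"] by (simp add: e)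
    finally have "2 / t * S (D \<omega> *\<^sub>R xbar + (1 / real m) *\<^sub>R R \<omega>) \<le> 2 / t * (t * \<bar>D \<omega>\<bar> + (1 / real m) * S (R \<omega>))"
      using \<open>t > 0\<close> by (intro mult_left_mono) auto
    also have "\<dots> = 2 * \<bar>D \<omega>\<bar> + 2 / (t * real m) * S (R \<omega>)"
      using \<open>t > 0\<close> m by (simp add: field_simps)
    finally show ?thesis
      using metric_projection_error_le[OF \<open>star_shaped K\<close> \<open>\<mu> *\<^sub>R xbar \<in> K\<close> assms(21)[OF that] \<open>t > 0\<close>]
      unfolding split S_def[symmetric] by linarith
  qed

  let ?B = "t + 2 / sqrt (real m) * (\<sigma> + \<eta> * (local_mean_width K t / t))"
  have W: "0 \<le> local_mean_width K t" by (rule nn_integral_local_support(2)[OF K t])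
  have B0: "0 \<le> ?B" using \<open>t > 0\<close> \<open>\<sigma> \<ge> 0\<close> \<open>\<eta> \<ge> 0\<close> W by simp
  have expand: "ennreal (t + (2 * d + c * s)) = ennreal t + (ennreal 2 * ennreal d + ennreal c * ennreal s)"
    if "0 \<le> c" "0 \<le> d" "0 \<le> s" for c d s :: real
    using that t by (simp add: ennreal_mult del: ennreal_numeral)
  have "(\<integral>\<^sup>+\<omega>. ennreal (norm (xhat \<omega> - \<mu> *\<^sub>R xbar)) \<partial>M)
      \<le> (\<integral>\<^sup>+\<omega>. (ennreal t + (ennreal 2 * ennreal \<bar>D \<omega>\<bar> + ennreal (2 / (t * real m)) * ennreal (S (R \<omega>)))) \<partial>M)"
  proof (rule nn_integral_mono)
    fix \<omega> assume "\<omega> \<in> space M"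
    from pointwise[OF this]
    have "ennreal (norm (xhat \<omega> - \<mu> *\<^sub>R xbar)) \<le> ennreal (t + (2 * \<bar>D \<omega>\<bar> + 2 / (t * real m) * S (R \<omega>)))"
      by (rule ennreal_leI)
    also have "\<dots> = ennreal t + (ennreal 2 * ennreal \<bar>D \<omega>\<bar> + ennreal (2 / (t * real m)) * ennreal (S (R \<omega>)))"
      by (rule expand) (use t m S_nonneg in simp_all)
    finally show "ennreal (norm (xhat \<omega> - \<mu> *\<^sub>R xbar))
      \<le> ennreal t + (ennreal 2 * ennreal \<bar>D \<omega>\<bar> + ennreal (2 / (t * real m)) * ennreal (S (R \<omega>)))" .
  qed
  also have "\<dots> = ennreal t + (ennreal 2 * (\<integral>\<^sup>+\<omega>. ennreal \<bar>D \<omega>\<bar> \<partial>M)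
      + ennreal (2 / (t * real m)) * (\<integral>\<^sup>+\<omega>. ennreal (S (R \<omega>)) \<partial>M))"
    by (simp add: nn_integral_add nn_integral_cmult emeasure_space_1 del: ennreal_numeral)
  also have "\<dots> \<le> ennreal t + (ennreal 2 * ennreal (\<sigma> / sqrt (real m))
      + ennreal (2 / (t * real m)) * ennreal (sqrt (real m) * \<eta> * local_mean_width K t))"
    by (intro add_mono mult_left_mono dev fluct order_refl) auto
  also have "\<dots> = ennreal (t + (2 * (\<sigma> / sqrt (real m)) + 2 / (t * real m) * (sqrt (real m) * \<eta> * local_mean_width K t)))"
    using t m W \<open>\<sigma> \<ge> 0\<close> \<open>\<eta> \<ge> 0\<close>
    by (simp add: ennreal_mult[symmetric] ennreal_plus[symmetric] del: ennreal_numeral ennreal_plus)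
  also have "t + (2 * (\<sigma> / sqrt (real m)) + 2 / (t * real m) * (sqrt (real m) * \<eta> * local_mean_width K t)) = ?B"
  proof -
    have "real m = sqrt (real m) * sqrt (real m)" by simp
    then have "sqrt (real m) / real m = 1 / sqrt (real m)"
      using m by (metis divide_divide_eq_left divide_self_if less_irrefl real_sqrt_eq_zero_cancel_iff)
    moreover have "2 / (t * real m) * (sqrt (real m) * \<eta> * local_mean_width K t)
       = 2 / t * (sqrt (real m) / real m) * (\<eta> * local_mean_width K t)"
      by simp
    ultimately have "2 / (t * real m) * (sqrt (real m) * \<eta> * local_mean_width K t)
       = 2 / t * (1 / sqrt (real m)) * (\<eta> * local_mean_width K t)"
      by simp
    then show ?thesis by (simp only:) (simp add: distrib_left mult_ac)
  qed
  finally have bound: "(\<integral>\<^sup>+\<omega>. ennreal (norm (xhat \<omega> - \<mu> *\<^sub>R xbar)) \<partial>M) \<le> ennreal ?B" .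
  have int: "integrable M (\<lambda>\<omega>. norm (xhat \<omega> - \<mu> *\<^sub>R xbar))"
  proof (rule integrableI_bounded)
    show "(\<integral>\<^sup>+\<omega>. ennreal (norm (norm (xhat \<omega> - \<mu> *\<^sub>R xbar))) \<partial>M) < \<infinity>"
      using le_less_trans[OF bound, of \<infinity>] by simp
  qed measurable
  moreover have "expectation (\<lambda>\<omega>. norm (xhat \<omega> - \<mu> *\<^sub>R xbar)) \<le> ?B"
    using bound B0 int by (simp add: nn_integral_eq_integral ennreal_le_iff)
  ultimately show ?thesis ..
qed

end
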